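(* For every $J\in\mathbb{S}$, the Gaussian curvature $K$ of the two-dimensional submanifold $D\left(\frac\pi2,\mathcal{C}(J)\right)$ of $(\mathbb{B},g)$ (with the metric induced by $g$) is positive. In particular, the sectional curvature of $(\mathbb{B},g)$ is positive on all sections $D\left(\frac\pi2,\mathcal{C}(J)\right)$, while it is negative on all slices $\mathbb{B}_I$, $I\in\mathbb{S}$.
   Context: $\mathbb{H}$ is the skew-field of quaternions, $\mathbb{B}=\{q\in\mathbb{H}:|q|<1\}$, $\mathbb{S}=\{q\in\mathbb{H}:q^2=-1\}$, $L_I=\mathbb{R}+\mathbb{R}I$ and $\mathbb{B}_I=\mathbb{B}\cap L_I$ for $I\in\mathbb{S}$. For $J\in\mathbb{S}$, $\mathcal{C}(J)=\mathbb{S}\cap L_J^\perp$ is the great circle of $\mathbb{S}$ orthogonal to $J$, and $D\left(\frac\pi2,\mathcal{C}(J)\right)=\{rI:\ r\in[0,1),\ I\in\mathcal{C}(J)\}$. The sectional curvature "on $D(\frac\pi2,\mathcal{C}(J))$" (resp. "on $\mathbb{B}_I$") means that of the tangent planes to that surface. $g$ is the Riemannian metric on $\mathbb{B}$ given, for $w=x+yI_w\in\mathbb{B}$ and $d=d_1+d_2\in T_w\mathbb{B}\cong\mathbb{H}$ with $d_1\in L_{I_w}$, $d_2\in L_{I_w}^\perp$ (Euclidean orthogonal complement), by $|d|^2_{g(w)}=\frac{|d_1|^2}{(1-|w|^2)^2}+\frac{|d_2|^2}{|1-w^2|^2}$. *)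

theory Defs
  imports "HOL-Analysis.Analysis"
begin

section \<open>Smooth maps, surfaces and tangent spaces\<close>

primrec Ck_on :: "nat \<Rightarrow> ('a::real_normed_vector \<Rightarrow> 'b::real_normed_vector) \<Rightarrow> 'a set \<Rightarrow> bool" where
  "Ck_on 0 f U \<longleftrightarrow> continuous_on U f"
| "Ck_on (Suc k) f U \<longleftrightarrow>
     f differentiable_on U \<and> (\<forall>v. Ck_on k (\<lambda>x. frechet_derivative f (at x) v) U)"

definition smooth_on :: "('a::real_normed_vector \<Rightarrow> 'b::real_normed_vector) \<Rightarrow> 'a set \<Rightarrow> bool" where
  "smooth_on f U \<longleftrightarrow> open U \<and> (\<forall>k. Ck_on k f U)"

definition local_param :: "'a::euclidean_space set \<Rightarrow> (real^2) set \<Rightarrow> (real^2 \<Rightarrow> 'a) \<Rightarrow> bool" where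
  "local_param M U \<phi> \<longleftrightarrow>
     smooth_on \<phi> U \<and>
     (\<forall>x\<in>U. inj (frechet_derivative \<phi> (at x))) \<and>
     openin (top_of_set M) (\<phi> ` U) \<and>
     (\<exists>\<psi>. homeomorphism U (\<phi> ` U) \<phi> \<psi>)"

definition tangent_space :: "'a::euclidean_space set \<Rightarrow> 'a \<Rightarrow> 'a set" where
  "tangent_space M p =
     {vector_derivative c (at 0) | (c :: real \<Rightarrow> 'a) e.
        0 < e \<and> smooth_on c {-e<..<e} \<and> c ` {-e<..<e} \<subseteq> M \<and> c 0 = p}"

section \<open>Curvature of a Riemannian metric on an open subset of a Euclidean space\<close>

text \<open>
  A metric is a function \<open>G\<close> with \<open>G x v w\<close> the inner product of \<open>v\<close> and \<open>w\<close>, viewed as tangent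
  vectors at \<open>x\<close>. The arguments \<open>u\<close>, \<open>v\<close>, \<open>w\<close> below stand for constant vector fields; these
  commute, so the Koszul formula for \<open>christoffel G x u v\<close> (the value of \<open>\<nabla>\<^sub>u v\<close> at \<open>x\<close>) and the
  formula for the curvature tensor contain no bracket terms. The sign convention is
  \<open>R(u,v)w = \<nabla>\<^sub>u \<nabla>\<^sub>v w - \<nabla>\<^sub>v \<nabla>\<^sub>u w - \<nabla>\<^sub>[\<^sub>u\<^sub>,\<^sub>v\<^sub>] w\<close>.
\<close>

type_synonym 'a metric_field = "'a \<Rightarrow> 'a \<Rightarrow> 'a \<Rightarrow> real"

definition dir_deriv :: "('a::real_normed_vector \<Rightarrow> 'b::real_normed_vector) \<Rightarrow> 'a \<Rightarrow> 'a \<Rightarrow> 'b" where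
  "dir_deriv f x u = frechet_derivative f (at x) u"

definition christoffel :: "'a::euclidean_space metric_field \<Rightarrow> 'a \<Rightarrow> 'a \<Rightarrow> 'a \<Rightarrow> 'a" where
  "christoffel G x u v =
     (THE z. \<forall>w. G x z w =
        (dir_deriv (\<lambda>y. G y v w) x u + dir_deriv (\<lambda>y. G y u w) x v
          - dir_deriv (\<lambda>y. G y u v) x w) / 2)"

definition riemann :: "'a::euclidean_space metric_field \<Rightarrow> 'a \<Rightarrow> 'a \<Rightarrow> 'a \<Rightarrow> 'a \<Rightarrow> 'a" where
  "riemann G x u v w =
     dir_deriv (\<lambda>y. christoffel G y v w) x u - dir_deriv (\<lambda>y. christoffel G y u w) x v
     + christoffel G x u (christoffel G x v w) - christoffel G x v (christoffel G x u w)"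

definition sectional_curvature :: "'a::euclidean_space metric_field \<Rightarrow> 'a \<Rightarrow> 'a set \<Rightarrow> real" where
  "sectional_curvature G x P =
     (THE k. \<exists>u v. u \<noteq> v \<and> independent {u, v} \<and> span {u, v} = P \<and>
        k = G x (riemann G x u v v) u / (G x u u * G x v v - (G x u v)\<^sup>2))"

definition pullback :: "('b::euclidean_space \<Rightarrow> 'a::euclidean_space) \<Rightarrow> 'a metric_field \<Rightarrow> 'b metric_field" where
  "pullback \<phi> G x v w =
     G (\<phi> x) (frechet_derivative \<phi> (at x) v) (frechet_derivative \<phi> (at x) w)"

text \<open>
  The Gaussian curvature at \<open>p\<close> of a surface \<open>M\<close> with the metric induced by \<open>G\<close>: the curvature of
  the pulled back metric in a local parametrization around \<open>p\<close>.
\<close>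

definition gaussian_curvature :: "'a::euclidean_space metric_field \<Rightarrow> 'a set \<Rightarrow> 'a \<Rightarrow> real" where
  "gaussian_curvature G M p =
     (THE k. \<exists>U \<phi> x. local_param M U \<phi> \<and> x \<in> U \<and> \<phi> x = p \<and>
        k = sectional_curvature (pullback \<phi> G) x UNIV)"

section \<open>Quaternions\<close>

text \<open>
  A quaternion is the pair of its real part and its imaginary part; the norm and the inner product
  of the product type are the Euclidean ones.
\<close>

type_synonym quat = "real \<times> (real^3)"

definition qone :: quat where
  "qone = (1, 0)"

definition qmult :: "quat \<Rightarrow> quat \<Rightarrow> quat" where
  "qmult p q = (fst p * fst q - snd p \<bullet> snd q,
                fst p *\<^sub>R snd q + fst q *\<^sub>R snd p + cross3 (snd p) (snd q))"

definition qball :: "quat set" where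
  "qball = {q. norm q < 1}"

definition im_units :: "quat set" where
  "im_units = {q. qmult q q = - qone}"

definition qslice :: "quat \<Rightarrow> quat set" where
  "qslice I = {x *\<^sub>R qone + y *\<^sub>R I | x y. True}"

definition ball_slice :: "quat \<Rightarrow> quat set" where
  "ball_slice I = qball \<inter> qslice I"

definition great_circle :: "quat \<Rightarrow> quat set" where
  "great_circle J = im_units \<inter> (qslice J)\<^sup>\<bottom>"

definition disc_section :: "quat \<Rightarrow> quat set" where
  "disc_section J = {r *\<^sub>R I | r I. 0 \<le> r \<and> r < 1 \<and> I \<in> great_circle J}"

section \<open>The metric\<close>

text \<open>
  For real \<open>w\<close> the unit \<open>I\<close> is not determined by \<open>w\<close>, but then the two weights agree (for
  \<open>norm w < 1\<close>) and the value does not depend on \<open>I\<close>.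
\<close>

definition g_normsq :: "quat \<Rightarrow> quat \<Rightarrow> real" where
  "g_normsq w d =
     (THE r. \<exists>I d1 d2. I \<in> im_units \<and> w \<in> qslice I \<and>
        d1 \<in> qslice I \<and> d2 \<in> (qslice I)\<^sup>\<bottom> \<and> d = d1 + d2 \<and>
        r = (norm d1)\<^sup>2 / (1 - (norm w)\<^sup>2)\<^sup>2 + (norm d2)\<^sup>2 / (norm (qone - qmult w w))\<^sup>2)"

text \<open>The bilinear form is recovered from the quadratic form by polarization.\<close>

definition g_metric :: "quat metric_field" where
  "g_metric w u v = (g_normsq w (u + v) - g_normsq w (u - v)) / 4"

end

theory Submission
  imports Defs
begin

text \<open>
  Write a quaternion as \<open>p = (x, v)\<close> with \<open>x\<close> real and \<open>v\<close> a vector of \<open>\<real>\<^sup>3\<close>, and put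
  \<open>A = (1 - \<bar>p\<bar>\<^sup>2)\<^sup>2\<close> and \<open>B = \<bar>1 - p\<^sup>2\<bar>\<^sup>2 = A + 4 \<bar>v\<bar>\<^sup>2\<close>. As \<open>1/A - 1/B = 4 \<bar>v\<bar>\<^sup>2 / (A B)\<close>, the
  decomposition of a tangent vector along the slice through \<open>p\<close> can be eliminated from the
  definition of \<open>g\<close>: for \<open>d = (d\<^sub>0, \<delta>)\<close>,
  \<open>g(d,d) = d\<^sub>0\<^sup>2 / A + \<bar>\<delta>\<bar>\<^sup>2 / B + 4 (\<delta> \<bullet> v)\<^sup>2 / (A B)\<close>, which is smooth across the real axis
  (\<open>g_metric_eq\<close>). The Gram operator of this form has the polynomial inverse \<open>sharp\<close>, so the
  Levi-Civita connection is an explicit rational expression (\<open>levi_civita_g\<close>).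

  Every set in the theorem is the intersection of the unit ball with a plane through the origin,
  and that plane is totally geodesic: on it the connection takes its values in the plane
  (\<open>g_connection_slice\<close>, \<open>g_connection_perp\<close>). Both restrictions are moreover invariant under
  rotation about the origin, so one computation (\<open>curvature_radial\<close>) gives both curvatures. On a
  slice \<open>g\<close> is the Poincare metric \<open>\<bar>d\<bar>\<^sup>2 / (1 - \<bar>p\<bar>\<^sup>2)\<^sup>2\<close>, of curvature \<open>-4\<close>. On the orthogonal
  disc \<open>g\<close> reads \<open>dr\<^sup>2 / (1 - r\<^sup>2)\<^sup>2 + r\<^sup>2 d\<theta>\<^sup>2 / (1 + r\<^sup>2)\<^sup>2\<close> in polar coordinates; with \<open>r = tanh s\<close> this
  is \<open>ds\<^sup>2 + f(s)\<^sup>2 d\<theta>\<^sup>2\<close> for \<open>f(s) = tanh(2 s) / 2\<close>, of curvature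
  \<open>- f'' / f = 8 (1 - r\<^sup>2)\<^sup>2 / (1 + r\<^sup>2)\<^sup>2 > 0\<close>.

  Gaussian curvature is taken in an arbitrary smooth parametrization \<open>\<phi>\<close>, and therefore needs the
  invariance of curvature. For \<open>\<phi>\<close> with values in a totally geodesic plane, the connection \<open>\<Gamma>'\<close> of
  the pulled back metric satisfies \<open>d\<phi>(\<Gamma>'(u,v)) = \<Gamma>(d\<phi> u, d\<phi> v) + d\<^sup>2\<phi>(u,v)\<close>. Differentiating this once
  more, all terms with higher derivatives of \<open>\<phi>\<close> are symmetric in the first two arguments and cancel,
  which leaves \<open>d\<phi>(R'(u,v)w) = R(d\<phi> u, d\<phi> v) d\<phi> w\<close> (\<open>riemann_pullback\<close>). So intrinsic and ambient
  curvature agree (\<open>gaussian_curvature_plane\<close>).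
\<close>

section \<open>Calculus: directional derivatives\<close>

lemma dir_derivI: "(f has_derivative f') (at x) \<Longrightarrow> dir_deriv f x u = f' u"
  unfolding dir_deriv_def using frechet_derivative_at by metis

lemma has_derivative_dir_deriv:
  "f differentiable (at x) \<Longrightarrow> (f has_derivative dir_deriv f x) (at x)"
  unfolding dir_deriv_def by (simp add: frechet_derivative_works[symmetric])

lemma linear_dir_deriv: "f differentiable (at x) \<Longrightarrow> linear (dir_deriv f x)"
  using has_derivative_dir_deriv has_derivative_linear by blast

lemma dir_deriv_cong:
  assumes "open S" "x \<in> S" "\<And>y. y \<in> S \<Longrightarrow> f y = g y"
  shows "dir_deriv f x u = dir_deriv g x u"
proof -
  have "(f has_derivative f') (at x) \<longleftrightarrow> (g has_derivative f') (at x)" for f'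
    using assms has_derivative_transform_within_open[of _ _ x UNIV S] by metis
  then show ?thesis
    by (simp add: dir_deriv_def frechet_derivative_def)
qed

lemma differentiable_cong_open:
  assumes "open S" "x \<in> S" "\<And>y. y \<in> S \<Longrightarrow> f y = g y" "f differentiable (at x)"
  shows "g differentiable (at x)"
  using assms has_derivative_transform_within_open[of f _ x UNIV S g]
  unfolding differentiable_def by metis

text \<open>
  The subspace is the common kernel of the functionals orthogonal to it, and each of these vanishes along \<open>f\<close>.
\<close>

lemma dir_deriv_mem_subspace:
  fixes f :: "'b::real_normed_vector \<Rightarrow> 'a::euclidean_space"
  assumes P: "subspace P" and "open U" "x \<in> U" and fP: "\<And>y. y \<in> U \<Longrightarrow> f y \<in> P"
    and d: "f differentiable (at x)"
  shows "dir_deriv f x v \<in> P"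
proof -
  have "orthogonal n (dir_deriv f x v)" if n: "n \<in> P\<^sup>\<bottom>" for n
  proof -
    have z: "n \<bullet> f y = 0" if "y \<in> U" for y
      using n fP[OF that] by (auto simp: orthogonal_comp_def orthogonal_def inner_commute)
    have "((\<lambda>y. n \<bullet> f y) has_derivative (\<lambda>v. n \<bullet> dir_deriv f x v)) (at x)"
      by (intro has_derivative_inner_right has_derivative_dir_deriv d)
    moreover have "((\<lambda>y. n \<bullet> f y) has_derivative (\<lambda>v. 0)) (at x)"
      by (rule has_derivative_transform_within_open[of "\<lambda>_. 0" _ _ UNIV U])
        (use assms z in auto)
    ultimately show ?thesis
      unfolding orthogonal_def using has_derivative_unique by metis
  qed
  then have "dir_deriv f x v \<in> P\<^sup>\<bottom>\<^sup>\<bottom>"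
    by (auto simp: orthogonal_comp_def[of "P\<^sup>\<bottom>"])
  then show ?thesis
    using orthogonal_comp_self[OF P] by simp
qed

text \<open>
  A derivative in the direction \<open>u\<close> only sees the line through \<open>x\<close>, which stays in
  the subspace. This is what allows the curvature on a totally geodesic plane to be computed from the
  simpler formula that the connection has there.
\<close>

lemma dir_deriv_eq_on_subspace:
  fixes f g :: "'b::real_normed_vector \<Rightarrow> 'a::real_normed_vector"
  assumes P: "subspace P" and S: "open S" "x \<in> S" "x \<in> P" and u: "u \<in> P"
    and eq: "\<And>y. y \<in> S \<Longrightarrow> y \<in> P \<Longrightarrow> f y = g y"
    and d: "f differentiable (at x)" "g differentiable (at x)"
  shows "dir_deriv f x u = dir_deriv g x u"
proof -
  define l where "l t = x + t *\<^sub>R u" for t :: real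
  have l: "(l has_derivative (\<lambda>t. t *\<^sub>R u)) (at 0)"
    unfolding l_def by (auto intro!: derivative_eq_intros)
  have l0: "l 0 = x" by (simp add: l_def)
  have c: "((\<lambda>t. h (l t)) has_derivative (\<lambda>t. dir_deriv h x (t *\<^sub>R u))) (at 0)"
    if "h differentiable (at x)" for h :: "'b \<Rightarrow> 'a"
    using has_derivative_compose[OF l, of h "dir_deriv h x"] has_derivative_dir_deriv[OF that] l0
    by simp
  have "continuous_on UNIV l"
    unfolding l_def by (intro continuous_intros)
  then have o: "open (l -` S)"
    using S(1) by (simp add: continuous_on_open_vimage)
  have "l t \<in> P" for t
    unfolding l_def using P S(3) u by (simp add: subspace_add subspace_mul)
  then have "((\<lambda>t. f (l t)) has_derivative (\<lambda>t. dir_deriv g x (t *\<^sub>R u))) (at 0)"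
    using eq S l0 by (intro has_derivative_transform_within_open[OF c[OF d(2)] o]) auto
  then have "(\<lambda>t. dir_deriv f x (t *\<^sub>R u)) = (\<lambda>t. dir_deriv g x (t *\<^sub>R u))"
    using c[OF d(1)] has_derivative_unique by blast
  from fun_cong[OF this, of 1] show ?thesis by simp
qed

lemma smooth_onD:
  assumes "smooth_on f U"
  shows "open U" "x \<in> U \<Longrightarrow> f differentiable (at x)" "smooth_on (\<lambda>x. dir_deriv f x v) U"
proof -
  have *: "open U" "\<And>k. Ck_on k f U"
    using assms by (auto simp: smooth_on_def)
  show "open U" by fact
  show "x \<in> U \<Longrightarrow> f differentiable (at x)"
    using *(2)[of 1] *(1) by (auto simp: differentiable_on_eq_differentiable_at)
  show "smooth_on (\<lambda>x. dir_deriv f x v) U"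
    using * Ck_on.simps(2)[of _ f U] by (auto simp: smooth_on_def dir_deriv_def)
qed

lemma Ck_on_const: "Ck_on k (\<lambda>x. c) U"
  by (induction k arbitrary: c) (auto simp: differentiable_on_const)

lemma smooth_on_affine:
  assumes "bounded_linear L" "open U"
  shows "smooth_on (\<lambda>x. p + L x) U"
proof -
  have d: "((\<lambda>x. p + L x) has_derivative L) (at x)" for x
    using assms(1) by (auto intro!: derivative_eq_intros bounded_linear_imp_has_derivative)
  have f: "frechet_derivative (\<lambda>x. p + L x) (at x) = L" for x
    using frechet_derivative_at[OF d] by simp
  have "(\<lambda>x. p + L x) differentiable_on U"
    using d by (meson differentiable_at_imp_differentiable_on differentiable_def)
  then have "Ck_on k (\<lambda>x. p + L x) U" for k
    by (cases k) (auto simp: f Ck_on_const differentiable_imp_continuous_on)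
  then show ?thesis
    using assms by (auto simp: smooth_on_def)
qed

text \<open>
  Young's argument: the mean value theorem in the direction \<open>u\<close> turns the second difference into a
  first difference of the directional derivative, whose differentiability at \<open>x\<close> alone then suffices.
\<close>

lemma second_difference_limit:
  fixes f :: "'a::real_normed_vector \<Rightarrow> real"
  assumes U: "open U" "x \<in> U" and d: "\<And>y. y \<in> U \<Longrightarrow> f differentiable (at y)"
    and h: "((\<lambda>y. dir_deriv f y u) has_derivative h') (at x)"
  shows "((\<lambda>t. (f (x + t *\<^sub>R u + t *\<^sub>R v) - f (x + t *\<^sub>R u) - f (x + t *\<^sub>R v) + f x) / t\<^sup>2)
     \<longlongrightarrow> h' v) (at_right 0)"
proof (rule tendstoI)
  fix e :: real assume e: "0 < e"
  define C where "C = norm u + norm v + 1"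
  have C: "C > 0" by (simp add: C_def add_nonneg_pos)
  define h where "h y = dir_deriv f y u" for y
  have lin: "linear h'" using h has_derivative_linear by blast
  have "e / (3 * C) > 0" using e C by simp
  then obtain d1 where d1: "d1 > 0"
    "\<And>y. norm (y - x) < d1 \<Longrightarrow> norm (h y - h x - h' (y - x)) \<le> e / (3 * C) * norm (y - x)"
    using h unfolding has_derivative_at_alt h_def by blast
  obtain d2 where d2: "d2 > 0" "ball x d2 \<subseteq> U"
    using U open_contains_ball by blast
  define d where "d = min d1 d2 / C"
  have dpos: "d > 0" using d1 d2 C by (simp add: d_def)
  have "dist ((f (x + t *\<^sub>R u + t *\<^sub>R v) - f (x + t *\<^sub>R u) - f (x + t *\<^sub>R v) + f x) / t\<^sup>2) (h' v) < e"
    if t: "0 < t" "t < d" for t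
  proof -
    have tC: "t * C < d1" "t * C < d2"
      using t C by (auto simp: d_def field_simps)
    have small: "norm (s *\<^sub>R u + r *\<^sub>R v) \<le> t * C" if "0 \<le> s" "s \<le> t" "0 \<le> r" "r \<le> t" for s r
    proof -
      have "norm (s *\<^sub>R u + r *\<^sub>R v) \<le> s * norm u + r * norm v"
        using norm_triangle_ineq[of "s *\<^sub>R u" "r *\<^sub>R v"] that by simp
      also have "\<dots> \<le> t * norm u + t * norm v"
        using that by (intro add_mono mult_right_mono) auto
      also have "\<dots> \<le> t * C" using t by (simp add: C_def algebra_simps)
      finally show ?thesis .
    qed
    have dist_z: "dist x (x + z) = norm z" for z
      by (simp add: dist_norm)
    have inU: "x + (s *\<^sub>R u + r *\<^sub>R v) \<in> U" if "0 \<le> s" "s \<le> t" "0 \<le> r" "r \<le> t" for s r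
    proof -
      have "x + (s *\<^sub>R u + r *\<^sub>R v) \<in> ball x d2"
        using small[OF that] tC dist_z[of "s *\<^sub>R u + r *\<^sub>R v"] by simp
      then show ?thesis using d2 by blast
    qed
    \<comment> \<open>the mean value theorem is applied to this difference of two parallel segments\<close>
    define F where "F s = f (x + (s *\<^sub>R u + t *\<^sub>R v)) - f (x + (s *\<^sub>R u + 0 *\<^sub>R v))" for s
    have der1: "((\<lambda>s. f (x + (s *\<^sub>R u + r *\<^sub>R v))) has_derivative (\<lambda>k. k * h (x + (s *\<^sub>R u + r *\<^sub>R v)))) (at s)"
      if "0 \<le> s" "s \<le> t" "0 \<le> r" "r \<le> t" for s r
    proof -
      have df: "f differentiable (at (x + (s *\<^sub>R u + r *\<^sub>R v)))"
        using d inU[OF that] by blast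
      have l: "((\<lambda>s. x + (s *\<^sub>R u + r *\<^sub>R v)) has_derivative (\<lambda>k. k *\<^sub>R u)) (at s)"
        by (auto intro!: derivative_eq_intros)
      show ?thesis
        using has_derivative_compose[OF l has_derivative_dir_deriv[OF df]]
        by (simp add: h_def linear_scale[OF linear_dir_deriv[OF df]])
    qed
    have derF: "(F has_derivative (\<lambda>k. k * h (x + (s *\<^sub>R u + t *\<^sub>R v)) - k * h (x + (s *\<^sub>R u + 0 *\<^sub>R v)))) (at s within {0..t})"
      if "0 \<le> s" "s \<le> t" for s
      unfolding F_def using that t
      by (intro has_derivative_diff has_derivative_at_withinI[OF der1]) auto
    obtain s where s: "0 < s" "s < t" and
      F: "F t - F 0 = (t - 0) * h (x + (s *\<^sub>R u + t *\<^sub>R v)) - (t - 0) * h (x + (s *\<^sub>R u + 0 *\<^sub>R v))"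
      using mvt_simple[OF t(1), of F "\<lambda>s k. k * h (x + (s *\<^sub>R u + t *\<^sub>R v)) - k * h (x + (s *\<^sub>R u + 0 *\<^sub>R v))"] derF
      by auto
    have est: "\<bar>h (x + (s *\<^sub>R u + r *\<^sub>R v)) - h x - (s * h' u + r * h' v)\<bar> \<le> e * t / 3"
      if "0 \<le> r" "r \<le> t" for r
    proof -
      have sm: "norm (s *\<^sub>R u + r *\<^sub>R v) \<le> t * C" using small that s by simp
      have "\<bar>h (x + (s *\<^sub>R u + r *\<^sub>R v)) - h x - h' (s *\<^sub>R u + r *\<^sub>R v)\<bar> \<le> e / (3 * C) * norm (s *\<^sub>R u + r *\<^sub>R v)"
        using d1(2)[of "x + (s *\<^sub>R u + r *\<^sub>R v)"] sm tC by simp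
      also have "\<dots> \<le> e / (3 * C) * (t * C)"
        using sm e C by (intro mult_left_mono) auto
      also have "\<dots> = e * t / 3" using C by simp
      finally show ?thesis
        by (simp add: linear_add[OF lin] linear_scale[OF lin])
    qed
    have "F t - F 0 = f (x + t *\<^sub>R u + t *\<^sub>R v) - f (x + t *\<^sub>R u) - f (x + t *\<^sub>R v) + f x"
      by (simp add: F_def add.assoc)
    moreover have "\<bar>(F t - F 0) - t\<^sup>2 * h' v\<bar> \<le> t * (2 * e * t / 3)"
    proof -
      have "\<bar>h (x + (s *\<^sub>R u + t *\<^sub>R v)) - h (x + (s *\<^sub>R u + 0 *\<^sub>R v)) - t * h' v\<bar> \<le> 2 * e * t / 3"
        using est[OF less_imp_le[OF t(1)] order_refl] est[OF order_refl less_imp_le[OF t(1)]]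
        by linarith
      then have "t * \<bar>h (x + (s *\<^sub>R u + t *\<^sub>R v)) - h (x + (s *\<^sub>R u + 0 *\<^sub>R v)) - t * h' v\<bar> \<le> t * (2 * e * t / 3)"
        using t by (intro mult_left_mono) auto
      moreover have "(F t - F 0) - t\<^sup>2 * h' v = t * (h (x + (s *\<^sub>R u + t *\<^sub>R v)) - h (x + (s *\<^sub>R u + 0 *\<^sub>R v)) - t * h' v)"
        unfolding F by (simp add: algebra_simps power2_eq_square)
      ultimately show ?thesis
        using t by (simp add: abs_mult)
    qed
    moreover have "\<bar>D / t\<^sup>2 - h' v\<bar> < e" if "\<bar>D - t\<^sup>2 * h' v\<bar> \<le> t * (2 * e * t / 3)" for D
    proof -
      have "D / t\<^sup>2 - h' v = (D - t\<^sup>2 * h' v) / t\<^sup>2"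
        using t by (simp add: field_simps)
      then have "\<bar>D / t\<^sup>2 - h' v\<bar> = \<bar>D - t\<^sup>2 * h' v\<bar> / t\<^sup>2"
        by (simp add: abs_divide)
      also have "\<dots> \<le> t * (2 * e * t / 3) / t\<^sup>2"
        using that t by (intro divide_right_mono) auto
      also have "\<dots> = 2 * e / 3" using t by (simp add: field_simps power2_eq_square)
      also have "\<dots> < e" using e by simp
      finally show ?thesis .
    qed
    ultimately show ?thesis
      by (simp add: dist_real_def)
  qed
  then show "eventually (\<lambda>t. dist ((f (x + t *\<^sub>R u + t *\<^sub>R v) - f (x + t *\<^sub>R u) - f (x + t *\<^sub>R v) + f x) / t\<^sup>2) (h' v) < e) (at_right 0)"
    unfolding eventually_at_right[OF zero_less_one] using dpos by blast
qed

text \<open>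
  The second difference is symmetric in the two directions, hence so is its limit.
\<close>

lemma dir_deriv_commute:
  fixes f :: "'a::real_normed_vector \<Rightarrow> 'b::euclidean_space"
  assumes U: "open U" "x \<in> U" and d: "\<And>y. y \<in> U \<Longrightarrow> f differentiable (at y)"
    and dd: "\<And>v. (\<lambda>y. dir_deriv f y v) differentiable (at x)"
  shows "dir_deriv (\<lambda>y. dir_deriv f y v) x u = dir_deriv (\<lambda>y. dir_deriv f y u) x v"
proof (rule euclidean_eqI)
  fix b :: 'b
  define g where "g y = f y \<bullet> b" for y
  have dg: "(g has_derivative (\<lambda>v. dir_deriv f y v \<bullet> b)) (at y)" if "y \<in> U" for y
    unfolding g_def by (intro has_derivative_inner_left has_derivative_dir_deriv d that)
  then have gd: "g differentiable (at y)" if "y \<in> U" for y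
    using that differentiable_def by blast
  have h: "((\<lambda>y. dir_deriv g y v) has_derivative (\<lambda>u. dir_deriv (\<lambda>y. dir_deriv f y v) x u \<bullet> b)) (at x)" for v
  proof (rule has_derivative_transform_within_open[OF _ U])
    show "((\<lambda>y. dir_deriv f y v \<bullet> b) has_derivative (\<lambda>u. dir_deriv (\<lambda>y. dir_deriv f y v) x u \<bullet> b)) (at x)"
      by (intro has_derivative_inner_left has_derivative_dir_deriv dd)
  qed (use dir_derivI[OF dg] in simp)
  have "x + t *\<^sub>R u + t *\<^sub>R v = x + t *\<^sub>R v + t *\<^sub>R u" for t
    by simp
  then have "((\<lambda>t. (g (x + t *\<^sub>R u + t *\<^sub>R v) - g (x + t *\<^sub>R u) - g (x + t *\<^sub>R v) + g x) / t\<^sup>2)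
     \<longlongrightarrow> dir_deriv (\<lambda>y. dir_deriv f y v) x u \<bullet> b) (at_right 0)"
    using second_difference_limit[OF U gd h, of v u] by (simp add: algebra_simps)
  then show "dir_deriv (\<lambda>y. dir_deriv f y v) x u \<bullet> b = dir_deriv (\<lambda>y. dir_deriv f y u) x v \<bullet> b"
    using second_difference_limit[OF U gd h, of u v] tendsto_unique[of "at_right (0::real)"]
    by force
qed

text \<open>
  A product rule for a linear map depending on a point and applied to a moving vector. A linear map
  is determined by finitely many vectors, so differentiability of \<open>L y b\<close> for each fixed \<open>b\<close> suffices;
  this suits metrics and connections that are differentiated along constant vector fields.
\<close>

lemma has_derivative_linear_field:
  fixes L :: "'x::real_normed_vector \<Rightarrow> 'b::euclidean_space \<Rightarrow> 'd::real_normed_vector"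
  assumes U: "open U" "x \<in> U" and lin: "\<And>y. y \<in> U \<Longrightarrow> linear (L y)"
    and D: "\<And>b. ((\<lambda>y. L y b) has_derivative L' b) (at x)"
    and a: "(a has_derivative a') (at x)"
  shows "((\<lambda>y. L y (a y)) has_derivative (\<lambda>u. L' (a x) u + L x (a' u))) (at x)"
proof -
  have ex: "L y b = (\<Sum>i\<in>Basis. (b \<bullet> i) *\<^sub>R L y i)" if "y \<in> U" for y b
    using linear_sum[OF lin[OF that], of "\<lambda>i. (b \<bullet> i) *\<^sub>R i" Basis]
    by (simp add: linear_scale[OF lin[OF that]] euclidean_representation)
  have "((\<lambda>y. \<Sum>i\<in>Basis. (b \<bullet> i) *\<^sub>R L y i) has_derivative (\<lambda>u. \<Sum>i\<in>Basis. (b \<bullet> i) *\<^sub>R L' i u)) (at x)" for b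
    by (auto intro!: derivative_eq_intros D)
  then have "((\<lambda>y. L y b) has_derivative (\<lambda>u. \<Sum>i\<in>Basis. (b \<bullet> i) *\<^sub>R L' i u)) (at x)" for b
    by (rule has_derivative_transform_within_open[OF _ U]) (use ex in auto)
  then have L': "L' b u = (\<Sum>i\<in>Basis. (b \<bullet> i) *\<^sub>R L' i u)" for b u
    using has_derivative_unique[OF D] by metis
  have "((\<lambda>y. \<Sum>i\<in>Basis. (a y \<bullet> i) *\<^sub>R L y i) has_derivative
      (\<lambda>u. \<Sum>i\<in>Basis. (a x \<bullet> i) *\<^sub>R L' i u + (a' u \<bullet> i) *\<^sub>R L x i)) (at x)"
    by (intro has_derivative_sum has_derivative_scaleR has_derivative_inner_left a D)
  then have "((\<lambda>y. L y (a y)) has_derivative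
      (\<lambda>u. \<Sum>i\<in>Basis. (a x \<bullet> i) *\<^sub>R L' i u + (a' u \<bullet> i) *\<^sub>R L x i)) (at x)"
    by (rule has_derivative_transform_within_open[OF _ U]) (use ex in auto)
  then show ?thesis
    by (simp only: sum.distrib L'[of "a x", symmetric] ex[OF U(2), symmetric])
qed

lemma has_derivative_bilinear_field:
  fixes T :: "'a::real_normed_vector \<Rightarrow> 'b::euclidean_space \<Rightarrow> 'c::euclidean_space \<Rightarrow> 'd::real_normed_vector"
  assumes U: "open U" "x \<in> U" and \<phi>: "(\<phi> has_derivative \<phi>') (at x)" "\<And>y. y \<in> U \<Longrightarrow> \<phi> y \<in> S"
    and bil: "\<And>y. y \<in> S \<Longrightarrow> bilinear (T y)"
    and D: "\<And>b c. (\<lambda>y. T y b c) differentiable (at (\<phi> x))"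
    and a: "(a has_derivative a') (at x)" and b: "(b has_derivative b') (at x)"
  shows "((\<lambda>y. T (\<phi> y) (a y) (b y)) has_derivative
    (\<lambda>u. dir_deriv (\<lambda>y. T y (a x) (b x)) (\<phi> x) (\<phi>' u) + T (\<phi> x) (a x) (b' u) + T (\<phi> x) (a' u) (b x))) (at x)"
proof -
  have 0: "((\<lambda>y. T (\<phi> y) i j) has_derivative (\<lambda>u. dir_deriv (\<lambda>y. T y i j) (\<phi> x) (\<phi>' u))) (at x)" for i j
    by (rule has_derivative_compose[OF \<phi>(1) has_derivative_dir_deriv[OF D]])
  have 1: "((\<lambda>y. T (\<phi> y) i (b y)) has_derivative
      (\<lambda>u. dir_deriv (\<lambda>y. T y i (b x)) (\<phi> x) (\<phi>' u) + T (\<phi> x) i (b' u))) (at x)" for i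
    using bil \<phi>(2) by (intro has_derivative_linear_field[OF U _ 0 b]) (auto simp: bilinear_def)
  show ?thesis
    using bil \<phi>(2) by (intro has_derivative_linear_field[OF U _ 1 a]) (auto simp: bilinear_def)
qed

section \<open>Levi-Civita connections and totally geodesic planes\<close>

lemma independent_pairD:
  fixes u v :: "'a::real_vector"
  assumes "u \<noteq> v" "independent {u, v}"
  shows "v \<noteq> 0" "u \<noteq> c *\<^sub>R v"
proof -
  have "u \<notin> span {v}" "independent {v}"
    using assms by (auto simp: independent_insert)
  then show "v \<noteq> 0" "u \<noteq> c *\<^sub>R v"
    by (auto simp: span_singleton)
qed

text \<open>
  Subtract from \<open>u\<close> its projection to the line of \<open>v\<close>; what remains is nonzero and has positive square.
\<close>

lemma gram_pos:
  fixes B :: "'a::real_vector \<Rightarrow> 'a \<Rightarrow> real"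
  assumes bil: "bilinear B" and sym: "\<And>u v. B u v = B v u" and pos: "\<And>v. v \<noteq> 0 \<Longrightarrow> 0 < B v v"
    and v: "v \<noteq> 0" and u: "\<And>c. u \<noteq> c *\<^sub>R v"
  shows "0 < B u u * B v v - (B u v)\<^sup>2"
proof -
  define c where "c = B u v / B v v"
  have v0: "0 < B v v" using pos v .
  have "0 < B (u - c *\<^sub>R v) (u - c *\<^sub>R v)"
    using u by (intro pos) auto
  also have "\<dots> = B u u - 2 * c * B u v + c\<^sup>2 * B v v"
    by (simp add: bilinear_lsub[OF bil] bilinear_rsub[OF bil] bilinear_lmul[OF bil] bilinear_rmul[OF bil]
        sym[of v u] algebra_simps power2_eq_square)
  also have "\<dots> = (B u u * B v v - (B u v)\<^sup>2) / B v v"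
    using v0 by (simp add: c_def field_simps power2_eq_square)
  finally show ?thesis
    using v0 by (simp add: zero_less_divide_iff)
qed

text \<open>
  The sectional curvature is a definite description over all bases of the plane. An identity for
  arbitrary \<open>u\<close> and \<open>v\<close> in the plane settles existence and uniqueness at once.
\<close>

lemma sectional_curvature_eqI:
  fixes G :: "'a::euclidean_space metric_field"
  assumes bil: "bilinear (G p)" and sym: "\<And>u v. G p u v = G p v u" and pos: "\<And>v. v \<noteq> 0 \<Longrightarrow> 0 < G p v v"
    and P: "subspace P" "dim P = 2"
    and R: "\<And>u v. u \<in> P \<Longrightarrow> v \<in> P \<Longrightarrow>
      G p (riemann G p u v v) u = \<kappa> * (G p u u * G p v v - (G p u v)\<^sup>2)"
  shows "sectional_curvature G p P = \<kappa>"
  unfolding sectional_curvature_def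
proof (rule the_equality)
  have val: "G p (riemann G p u v v) u / (G p u u * G p v v - (G p u v)\<^sup>2) = \<kappa>"
    if "u \<noteq> v" "independent {u, v}" "span {u, v} = P" for u v
  proof -
    have "0 < G p u u * G p v v - (G p u v)\<^sup>2"
      using independent_pairD[OF that(1,2)] by (intro gram_pos bil sym pos)
    moreover have "u \<in> P" "v \<in> P"
      using that(3) span_base[of _ "{u, v}"] by auto
    ultimately show ?thesis
      using R[of u v] by simp
  qed
  obtain B where B: "independent B" "card B = 2" "span B = P"
    using orthonormal_basis_subspace[OF P(1)] P(2) by metis
  then obtain u v where "B = {u, v}" "u \<noteq> v"
    by (meson card_2_iff)
  with B val show "\<exists>u v. u \<noteq> v \<and> independent {u, v} \<and> span {u, v} = P \<and>
      \<kappa> = G p (riemann G p u v v) u / (G p u u * G p v v - (G p u v)\<^sup>2)"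
    by metis
  show "k = \<kappa>" if "\<exists>u v. u \<noteq> v \<and> independent {u, v} \<and> span {u, v} = P \<and>
      k = G p (riemann G p u v v) u / (G p u u * G p v v - (G p u v)\<^sup>2)" for k
    using that val by blast
qed

text \<open>
  Cramer's rule for the normal equations, whose determinant is the Gram determinant of the two columns.
\<close>

lemma differentiable_linear_solve:
  fixes A :: "'x::real_normed_vector \<Rightarrow> real^2 \<Rightarrow> 'a::euclidean_space"
  assumes U: "open U" "x \<in> U" and lin: "\<And>y. y \<in> U \<Longrightarrow> linear (A y)" and inj: "\<And>y. y \<in> U \<Longrightarrow> inj (A y)"
    and dA: "\<And>b. (\<lambda>y. A y b) differentiable (at x)" and dF: "F differentiable (at x)"
    and z: "\<And>y. y \<in> U \<Longrightarrow> A y (z y) = F y"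
  shows "z differentiable (at x)"
proof -
  define e f :: "real^2" where "e = axis 1 1" and "f = axis 2 1"
  define a b where "a y = A y e" and "b y = A y f" for y
  define g where "g y = (a y \<bullet> a y) * (b y \<bullet> b y) - (a y \<bullet> b y)\<^sup>2" for y
  define w where "w y = (((F y \<bullet> a y) * (b y \<bullet> b y) - (F y \<bullet> b y) * (a y \<bullet> b y)) / g y) *\<^sub>R e
      + (((F y \<bullet> b y) * (a y \<bullet> a y) - (F y \<bullet> a y) * (a y \<bullet> b y)) / g y) *\<^sub>R f" for y
  have g: "0 < g y" if y: "y \<in> U" for y
    unfolding g_def
  proof (rule gram_pos)
    show "bilinear (\<lambda>u v::'a. u \<bullet> v)"
      using bilinear_conv_bounded_bilinear bounded_bilinear_inner by blast
    have *: "A y s = A y t \<Longrightarrow> s = t" for s t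
      using inj[OF y] by (simp add: inj_eq)
    show "b y \<noteq> 0"
      using *[of f 0] linear_0[OF lin[OF y]] by (auto simp: b_def f_def)
    show "a y \<noteq> c *\<^sub>R b y" for c
      using *[of e "c *\<^sub>R f"] linear_scale[OF lin[OF y]]
      by (auto simp: a_def b_def e_def f_def vec_eq_iff axis_def forall_2)
  qed (auto simp: inner_commute)
  have wz: "w y = z y" if y: "y \<in> U" for y
  proof -
    have z2: "z y = z y $ 1 *\<^sub>R e + z y $ 2 *\<^sub>R f"
      by (simp add: e_def f_def vec_eq_iff axis_def forall_2)
    have F: "F y = z y $ 1 *\<^sub>R a y + z y $ 2 *\<^sub>R b y"
      unfolding a_def b_def z[OF y, symmetric]
      by (subst z2) (simp add: linear_add[OF lin[OF y]] linear_scale[OF lin[OF y]])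
    have "(F y \<bullet> a y) * (b y \<bullet> b y) - (F y \<bullet> b y) * (a y \<bullet> b y) = z y $ 1 * g y"
      "(F y \<bullet> b y) * (a y \<bullet> a y) - (F y \<bullet> a y) * (a y \<bullet> b y) = z y $ 2 * g y"
      unfolding F g_def
      by (simp_all add: inner_add_left inner_commute[of "b y" "a y"] algebra_simps power2_eq_square)
    then show ?thesis
      using g[OF y] by (subst z2) (simp add: w_def)
  qed
  have ab: "a differentiable (at x)" "b differentiable (at x)"
    unfolding a_def b_def by (rule dA)+
  then have "g differentiable (at x)"
    unfolding g_def
    by (intro differentiable_diff differentiable_mult differentiable_power differentiable_inner)
  with ab have "w differentiable (at x)"
    unfolding w_def using g[OF U(2)] dF
    by (intro differentiable_add differentiable_diff differentiable_mult differentiable_divide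
        differentiable_scaleR differentiable_inner differentiable_const) auto
  then show ?thesis
    using differentiable_cong_open[of U x w z] U wz by simp
qed

text \<open>
  A metric together with a candidate \<open>\<Gamma>\<close> for its Levi-Civita connection on an open set, in the form in
  which an explicit \<open>\<Gamma>\<close> can be checked directly.
\<close>

locale levi_civita =
  fixes S :: "'a::euclidean_space set" and G :: "'a metric_field" and \<Gamma> :: "'a \<Rightarrow> 'a \<Rightarrow> 'a \<Rightarrow> 'a"
  assumes open_S: "open S"
    and bilinear_G: "y \<in> S \<Longrightarrow> bilinear (G y)"
    and sym_G: "y \<in> S \<Longrightarrow> G y u v = G y v u"
    and pos_G: "y \<in> S \<Longrightarrow> v \<noteq> 0 \<Longrightarrow> 0 < G y v v"
    and differentiable_G: "y \<in> S \<Longrightarrow> (\<lambda>y. G y u v) differentiable (at y)"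
    and bilinear_\<Gamma>: "y \<in> S \<Longrightarrow> bilinear (\<Gamma> y)"
    and differentiable_\<Gamma>: "y \<in> S \<Longrightarrow> (\<lambda>y. \<Gamma> y u v) differentiable (at y)"
    and koszul: "y \<in> S \<Longrightarrow> G y (\<Gamma> y u v) w =
        (dir_deriv (\<lambda>y. G y v w) y u + dir_deriv (\<lambda>y. G y u w) y v
          - dir_deriv (\<lambda>y. G y u v) y w) / 2"
begin

lemma nondegenerate:
  assumes y: "y \<in> S" and eq: "G y z (z - z') = G y z' (z - z')"
  shows "z = z'"
proof -
  have "G y (z - z') (z - z') = 0"
    using eq by (simp add: bilinear_lsub[OF bilinear_G[OF y]])
  then show ?thesis
    using pos_G[OF y, of "z - z'"] by auto
qed

lemma christoffel_eq:
  assumes "y \<in> S" shows "christoffel G y u v = \<Gamma> y u v"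
  unfolding christoffel_def
proof (rule the_equality)
  show "\<forall>w. G y (\<Gamma> y u v) w = (dir_deriv (\<lambda>y. G y v w) y u + dir_deriv (\<lambda>y. G y u w) y v
          - dir_deriv (\<lambda>y. G y u v) y w) / 2"
    using koszul[OF assms] by blast
qed (use nondegenerate koszul assms in metis)

lemma riemann_eq:
  assumes "y \<in> S"
  shows "riemann G y u v w = dir_deriv (\<lambda>y. \<Gamma> y v w) y u - dir_deriv (\<lambda>y. \<Gamma> y u w) y v
     + \<Gamma> y u (\<Gamma> y v w) - \<Gamma> y v (\<Gamma> y u w)"
  unfolding riemann_def
  using dir_deriv_cong[OF open_S assms christoffel_eq] assms by (simp add: christoffel_eq)

end

text \<open>
  A linear plane that is totally geodesic. Because constant vector fields are tangent to a linear
  subspace, this just says that \<open>\<Gamma>\<close> does not leave it.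
\<close>

locale geodesic_plane = levi_civita +
  fixes P
  assumes subspace_P: "subspace P" and dim_P: "dim P = 2"
    and \<Gamma>_P: "y \<in> S \<Longrightarrow> y \<in> P \<Longrightarrow> u \<in> P \<Longrightarrow> v \<in> P \<Longrightarrow> \<Gamma> y u v \<in> P"

locale plane_immersion = geodesic_plane +
  fixes U :: "(real^2) set" and \<phi>
  assumes smooth: "smooth_on \<phi> U"
    and inj: "x \<in> U \<Longrightarrow> inj (dir_deriv \<phi> x)"
    and image: "x \<in> U \<Longrightarrow> \<phi> x \<in> S" "x \<in> U \<Longrightarrow> \<phi> x \<in> P"
begin

abbreviation D where "D \<equiv> dir_deriv \<phi>"
abbreviation D2 where "D2 x u v \<equiv> dir_deriv (\<lambda>y. D y v) x u"

lemmas open_U = smooth_onD(1)[OF smooth]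
lemmas differentiable_\<phi> = smooth_onD(2)[OF smooth]
lemmas differentiable_D = smooth_onD(2)[OF smooth_onD(3)[OF smooth]]
lemmas differentiable_D2 = smooth_onD(2)[OF smooth_onD(3)[OF smooth_onD(3)[OF smooth]]]

lemma linear_D: "x \<in> U \<Longrightarrow> linear (D x)"
  by (simp add: differentiable_\<phi> linear_dir_deriv)

lemma D_mem: "x \<in> U \<Longrightarrow> D x v \<in> P"
  by (rule dir_deriv_mem_subspace[OF subspace_P open_U _ image(2) differentiable_\<phi>])

lemma D2_mem: "x \<in> U \<Longrightarrow> D2 x u v \<in> P"
  by (rule dir_deriv_mem_subspace[OF subspace_P open_U _ D_mem differentiable_D])

lemma D_eq_iff: "x \<in> U \<Longrightarrow> D x u = D x v \<longleftrightarrow> u = v"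
  using inj by (simp add: inj_eq)

lemma range_D:
  assumes "x \<in> U" shows "range (D x) = P"
proof (rule subspace_dim_equal)
  show "subspace (range (D x))"
    using linear_D[OF assms] by (simp add: linear_subspace_image)
  show "range (D x) \<subseteq> P"
    using D_mem[OF assms] by blast
  have "dim (range (D x)) = dim (UNIV :: (real^2) set)"
    using dim_image_eq[OF linear_D[OF assms]] inj[OF assms] by simp
  then show "dim P \<le> dim (range (D x))"
    by (simp add: dim_P)
qed (rule subspace_P)

lemma D2_commute: "x \<in> U \<Longrightarrow> D2 x u v = D2 x v u"
  by (rule dir_deriv_commute[OF open_U _ differentiable_\<phi> differentiable_D])

lemma D3_commute: "x \<in> U \<Longrightarrow> dir_deriv (\<lambda>y. D2 y v w) x u = dir_deriv (\<lambda>y. D2 y u w) x v"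
  by (rule dir_deriv_commute[OF open_U _ differentiable_D differentiable_D2])

lemma pullback_eq: "pullback \<phi> G x v w = G (\<phi> x) (D x v) (D x w)"
  by (simp add: pullback_def dir_deriv_def)

lemma dir_deriv_pullback:
  assumes x: "x \<in> U"
  shows "dir_deriv (\<lambda>y. pullback \<phi> G y v w) x u =
    dir_deriv (\<lambda>y. G y (D x v) (D x w)) (\<phi> x) (D x u) + G (\<phi> x) (D x v) (D2 x u w)
      + G (\<phi> x) (D2 x u v) (D x w)"
  unfolding pullback_eq
  by (intro dir_derivI has_derivative_bilinear_field[OF open_U x _ image(1) bilinear_G]
      has_derivative_dir_deriv differentiable_\<phi>[OF x] differentiable_D[OF x] differentiable_G image(1)[OF x])

text \<open>
  The connection of the pulled back metric, given by the transformation law of the Christoffel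
  symbols. The inverse makes sense because the right-hand side lies in the plane, which is the range
  of the differential.
\<close>

definition \<Gamma>\<phi> where "\<Gamma>\<phi> x u v = inv (D x) (\<Gamma> (\<phi> x) (D x u) (D x v) + D2 x u v)"

lemma D_\<Gamma>\<phi>:
  assumes x: "x \<in> U"
  shows "D x (\<Gamma>\<phi> x u v) = \<Gamma> (\<phi> x) (D x u) (D x v) + D2 x u v"
proof -
  have "\<Gamma> (\<phi> x) (D x u) (D x v) + D2 x u v \<in> range (D x)"
    unfolding range_D[OF x]
    using x by (intro subspace_add[OF subspace_P] \<Gamma>_P D_mem D2_mem image)
  then show ?thesis
    unfolding \<Gamma>\<phi>_def by (rule f_inv_into_f)
qed

lemma christoffel_pullback:
  assumes x: "x \<in> U"
  shows "christoffel (pullback \<phi> G) x u v = \<Gamma>\<phi> x u v"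
proof -
  let ?K = "\<lambda>w. (dir_deriv (\<lambda>y. pullback \<phi> G y v w) x u + dir_deriv (\<lambda>y. pullback \<phi> G y u w) x v
          - dir_deriv (\<lambda>y. pullback \<phi> G y u v) x w) / 2"
  have K: "pullback \<phi> G x (\<Gamma>\<phi> x u v) w = ?K w" for w
  proof -
    have "?K w = G (\<phi> x) (\<Gamma> (\<phi> x) (D x u) (D x v)) (D x w) + G (\<phi> x) (D2 x u v) (D x w)"
      unfolding dir_deriv_pullback[OF x] koszul[OF image(1)[OF x]]
      using D2_commute[OF x, of v u] D2_commute[OF x, of w u] D2_commute[OF x, of w v]
        sym_G[OF image(1)[OF x], of "D x v" "D2 x u w"]
      by (simp add: field_simps)
    then show ?thesis
      by (simp add: pullback_eq D_\<Gamma>\<phi>[OF x] bilinear_ladd[OF bilinear_G[OF image(1)[OF x]]])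
  qed
  show ?thesis
    unfolding christoffel_def
  proof (rule the_equality)
    show "\<forall>w. pullback \<phi> G x (\<Gamma>\<phi> x u v) w = ?K w" using K by blast
    fix z assume "\<forall>w. pullback \<phi> G x z w = ?K w"
    then have "pullback \<phi> G x z (z - \<Gamma>\<phi> x u v) = pullback \<phi> G x (\<Gamma>\<phi> x u v) (z - \<Gamma>\<phi> x u v)"
      unfolding K by blast
    then show "z = \<Gamma>\<phi> x u v"
      using nondegenerate[OF image(1)[OF x], of "D x z" "D x (\<Gamma>\<phi> x u v)"]
      by (simp add: pullback_eq linear_diff[OF linear_D[OF x]] D_eq_iff[OF x])
  qed
qed

lemma has_derivative_\<Gamma>_along:
  assumes x: "x \<in> U"
  shows "((\<lambda>y. \<Gamma> (\<phi> y) (D y v) (D y w)) has_derivative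
    (\<lambda>u. dir_deriv (\<lambda>y. \<Gamma> y (D x v) (D x w)) (\<phi> x) (D x u) + \<Gamma> (\<phi> x) (D x v) (D2 x u w)
      + \<Gamma> (\<phi> x) (D2 x u v) (D x w))) (at x)"
  by (intro has_derivative_bilinear_field[OF open_U x _ image(1) bilinear_\<Gamma>]
      has_derivative_dir_deriv differentiable_\<phi>[OF x] differentiable_D[OF x] differentiable_\<Gamma> image(1)[OF x])

lemma differentiable_\<Gamma>\<phi>:
  assumes x: "x \<in> U"
  shows "(\<lambda>y. \<Gamma>\<phi> y v w) differentiable (at x)"
proof (rule differentiable_linear_solve[OF open_U x linear_D inj differentiable_D[OF x] _ D_\<Gamma>\<phi>])
  show "(\<lambda>y. \<Gamma> (\<phi> y) (D y v) (D y w) + D2 y v w) differentiable (at x)"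
    using has_derivative_\<Gamma>_along[OF x] differentiable_D2[OF x]
    by (intro differentiable_add) (auto simp: differentiable_def)
qed

text \<open>
  The transformation law, differentiated in the direction \<open>u\<close>.
\<close>

lemma D_dir_deriv_\<Gamma>\<phi>:
  assumes x: "x \<in> U"
  shows "D x (dir_deriv (\<lambda>y. \<Gamma>\<phi> y v w) x u) =
    dir_deriv (\<lambda>y. \<Gamma> y (D x v) (D x w)) (\<phi> x) (D x u) + \<Gamma> (\<phi> x) (D x v) (D2 x u w)
      + \<Gamma> (\<phi> x) (D2 x u v) (D x w) + dir_deriv (\<lambda>y. D2 y v w) x u - D2 x u (\<Gamma>\<phi> x v w)"
proof -
  have 1: "((\<lambda>y. D y (\<Gamma>\<phi> y v w)) has_derivative
      (\<lambda>u. D2 x u (\<Gamma>\<phi> x v w) + D x (dir_deriv (\<lambda>y. \<Gamma>\<phi> y v w) x u))) (at x)"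
    by (rule has_derivative_linear_field[where L = D and L' = "\<lambda>b u. D2 x u b",
          OF open_U x linear_D has_derivative_dir_deriv[OF differentiable_D[OF x]]
            has_derivative_dir_deriv[OF differentiable_\<Gamma>\<phi>[OF x]]])
  have 2: "((\<lambda>y. D y (\<Gamma>\<phi> y v w)) has_derivative
      (\<lambda>u. dir_deriv (\<lambda>y. \<Gamma> y (D x v) (D x w)) (\<phi> x) (D x u) + \<Gamma> (\<phi> x) (D x v) (D2 x u w)
      + \<Gamma> (\<phi> x) (D2 x u v) (D x w) + dir_deriv (\<lambda>y. D2 y v w) x u)) (at x)"
    by (rule has_derivative_transform_within_open[OF
          has_derivative_add[OF has_derivative_\<Gamma>_along[OF x] has_derivative_dir_deriv[OF differentiable_D2[OF x]]]
          open_U x D_\<Gamma>\<phi>[symmetric]])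
  show ?thesis
    using fun_cong[OF has_derivative_unique[OF 1 2], of u] by (simp add: eq_diff_eq add.commute)
qed

text \<open>
  In the difference of the two orders of differentiation, the third derivatives of \<open>\<phi>\<close> cancel, and so do
  the terms \<open>\<Gamma>(D2 u v, D w)\<close> and \<open>\<Gamma>(D v, D2 u w) + \<Gamma>(D u, D2 v w)\<close>, which are symmetric in \<open>u\<close> and \<open>v\<close>.
\<close>

lemma riemann_pullback:
  assumes x: "x \<in> U"
  shows "D x (riemann (pullback \<phi> G) x u v w) = riemann G (\<phi> x) (D x u) (D x v) (D x w)"
proof -
  note lin = linear_add[OF linear_D[OF x]] linear_diff[OF linear_D[OF x]]
  have eq: "riemann (pullback \<phi> G) x u v w =
     dir_deriv (\<lambda>y. \<Gamma>\<phi> y v w) x u - dir_deriv (\<lambda>y. \<Gamma>\<phi> y u w) x v + \<Gamma>\<phi> x u (\<Gamma>\<phi> x v w) - \<Gamma>\<phi> x v (\<Gamma>\<phi> x u w)"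
    unfolding riemann_def
    using dir_deriv_cong[OF open_U x christoffel_pullback] x by (simp add: christoffel_pullback)
  show ?thesis
    using D3_commute[OF x, where u = u and v = v and w = w] D2_commute[OF x, of u v]
    by (simp add: eq riemann_eq[OF image(1)[OF x]] lin D_dir_deriv_\<Gamma>\<phi>[OF x] D_\<Gamma>\<phi>[OF x]
        bilinear_radd[OF bilinear_\<Gamma>[OF image(1)[OF x]]] algebra_simps)
qed

lemma sectional_curvature_pullback:
  assumes x: "x \<in> U"
    and R: "\<And>u v. u \<in> P \<Longrightarrow> v \<in> P \<Longrightarrow> G (\<phi> x) (riemann G (\<phi> x) u v v) u =
      \<kappa> * (G (\<phi> x) u u * G (\<phi> x) v v - (G (\<phi> x) u v)\<^sup>2)"
  shows "sectional_curvature (pullback \<phi> G) x UNIV = \<kappa>"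
proof (rule sectional_curvature_eqI)
  have "linear (\<lambda>v. G (\<phi> x) (D x u) (D x v))" "linear (\<lambda>v. G (\<phi> x) (D x v) (D x u))" for u
    using bilinear_G[OF image(1)[OF x]] linear_compose[OF linear_D[OF x]]
    by (auto simp: bilinear_def o_def)
  then show "bilinear (pullback \<phi> G x)"
    by (simp add: bilinear_def pullback_eq)
  show "pullback \<phi> G x u v = pullback \<phi> G x v u" for u v
    by (simp add: pullback_eq sym_G[OF image(1)[OF x]])
  show "0 < pullback \<phi> G x v v" if "v \<noteq> 0" for v
  proof -
    have "D x v \<noteq> 0"
      using that D_eq_iff[OF x, of v 0] linear_0[OF linear_D[OF x]] by simp
    then show ?thesis
      by (simp add: pullback_eq pos_G[OF image(1)[OF x]])
  qed
  show "pullback \<phi> G x (riemann (pullback \<phi> G) x u v v) u =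
      \<kappa> * (pullback \<phi> G x u u * pullback \<phi> G x v v - (pullback \<phi> G x u v)\<^sup>2)" for u v
    using R[OF D_mem[OF x] D_mem[OF x], of u v] by (simp add: pullback_eq riemann_pullback[OF x])
qed auto

end

section \<open>Rotationally symmetric connections, tangent spaces and Gaussian curvature\<close>

lemma plane_orthonormal_basis:
  fixes P :: "'a::euclidean_space set"
  assumes P: "subspace P" "dim P = 2"
  obtains e f where "e \<in> P" "f \<in> P" "e \<bullet> e = 1" "f \<bullet> f = 1" "e \<bullet> f = 0"
    "\<And>x. x \<in> P \<Longrightarrow> x = (x \<bullet> e) *\<^sub>R e + (x \<bullet> f) *\<^sub>R f"
proof -
  obtain B where B: "B \<subseteq> P" "pairwise orthogonal B" "\<And>x. x \<in> B \<Longrightarrow> norm x = 1"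
    "card B = 2" "span B = P"
    using orthonormal_basis_subspace[OF P(1)] P(2) by metis
  then obtain e f where ef: "B = {e, f}" "e \<noteq> f"
    by (meson card_2_iff)
  have n: "e \<bullet> e = 1" "f \<bullet> f = 1" "e \<bullet> f = 0"
    using B(2,3) ef by (auto simp: pairwise_def orthogonal_def norm_eq_1)
  have "x = (x \<bullet> e) *\<^sub>R e + (x \<bullet> f) *\<^sub>R f" if "x \<in> P" for x
  proof -
    have "x \<in> span {e, f}"
      using that B(5) ef(1) by simp
    then obtain r s where "x - r *\<^sub>R e = s *\<^sub>R f"
      by (auto simp: span_insert span_singleton)
    then have "x = r *\<^sub>R e + s *\<^sub>R f"
      by (simp add: algebra_simps)
    then show ?thesis
      using n by (simp add: inner_add_left inner_commute[of f e])
  qed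
  then show thesis
    using that[of e f] n B(1) ef by auto
qed

text \<open>
  The difference of the two sides is the Gram determinant of \<open>p, u, v\<close>, which vanishes for three
  vectors in a plane. It is the only point where the curvature computation uses dimension two.
\<close>

lemma plane_gram:
  fixes P :: "'a::euclidean_space set"
  assumes P: "subspace P" "dim P = 2" and "p \<in> P" "u \<in> P" "v \<in> P"
  shows "(u \<bullet> p)\<^sup>2 * (v \<bullet> v) + (v \<bullet> p)\<^sup>2 * (u \<bullet> u) - 2 * (u \<bullet> p) * (v \<bullet> p) * (u \<bullet> v) =
    (p \<bullet> p) * ((u \<bullet> u) * (v \<bullet> v) - (u \<bullet> v)\<^sup>2)"
proof -
  obtain e f where ef: "e \<bullet> e = 1" "f \<bullet> f = 1" "e \<bullet> f = 0"
    "\<And>x. x \<in> P \<Longrightarrow> x = (x \<bullet> e) *\<^sub>R e + (x \<bullet> f) *\<^sub>R f"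
    using plane_orthonormal_basis[OF P] by metis
  have "x \<bullet> y = (x \<bullet> e) * (y \<bullet> e) + (x \<bullet> f) * (y \<bullet> f)" if "x \<in> P" "y \<in> P" for x y
  proof -
    have "x \<bullet> y = ((x \<bullet> e) *\<^sub>R e + (x \<bullet> f) *\<^sub>R f) \<bullet> y"
      using ef(4)[OF that(1)] by simp
    then show ?thesis
      by (simp add: inner_add_left inner_commute[of e y] inner_commute[of f y])
  qed
  note i = this[OF assms(3,3)] this[OF assms(4,3)] this[OF assms(5,3)] this[OF assms(4,4)]
    this[OF assms(4,5)] this[OF assms(5,5)]
  show ?thesis
    unfolding i by algebra
qed

text \<open>
  The general shape of the Christoffel symbols of a rotationally symmetric metric
  \<open>q(\<bar>p\<bar>\<^sup>2) \<bar>d\<bar>\<^sup>2 + s(\<bar>p\<bar>\<^sup>2) (d \<bullet> p)\<^sup>2\<close>.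
\<close>

definition radial_connection ::
  "(real \<Rightarrow> real) \<Rightarrow> (real \<Rightarrow> real) \<Rightarrow> (real \<Rightarrow> real) \<Rightarrow> 'a::real_inner \<Rightarrow> 'a \<Rightarrow> 'a \<Rightarrow> 'a" where
  "radial_connection a b c p u w =
     a (p \<bullet> p) *\<^sub>R ((u \<bullet> p) *\<^sub>R w + (w \<bullet> p) *\<^sub>R u) + (b (p \<bullet> p) * (u \<bullet> w)) *\<^sub>R p
     + (c (p \<bullet> p) * ((u \<bullet> p) * (w \<bullet> p))) *\<^sub>R p"

lemma has_derivative_radial_connection:
  assumes "(a has_real_derivative a') (at (p \<bullet> p))" "(b has_real_derivative b') (at (p \<bullet> p))"
    "(c has_real_derivative c') (at (p \<bullet> p))"
  shows "((\<lambda>p. radial_connection a b c p v w) has_derivative (\<lambda>u.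
      (2 * a' * (u \<bullet> p)) *\<^sub>R ((v \<bullet> p) *\<^sub>R w + (w \<bullet> p) *\<^sub>R v)
    + a (p \<bullet> p) *\<^sub>R ((v \<bullet> u) *\<^sub>R w + (w \<bullet> u) *\<^sub>R v)
    + (2 * b' * (u \<bullet> p) * (v \<bullet> w)) *\<^sub>R p + (b (p \<bullet> p) * (v \<bullet> w)) *\<^sub>R u
    + (2 * c' * (u \<bullet> p) * ((v \<bullet> p) * (w \<bullet> p)) + c (p \<bullet> p) * ((v \<bullet> u) * (w \<bullet> p) + (v \<bullet> p) * (w \<bullet> u))) *\<^sub>R p
    + (c (p \<bullet> p) * ((v \<bullet> p) * (w \<bullet> p))) *\<^sub>R u)) (at p)"
proof -
  have sq: "((\<lambda>p. p \<bullet> p) has_derivative (\<lambda>u. 2 * (u \<bullet> p))) (at p)"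
    by (auto intro!: derivative_eq_intros simp: inner_commute)
  have comp: "((\<lambda>p. f (p \<bullet> p)) has_derivative (\<lambda>u. 2 * f' * (u \<bullet> p))) (at p)"
    if "(f has_real_derivative f') (at (p \<bullet> p))" for f f'
    using has_derivative_compose[OF sq, of f "(*) f'"] that
    by (simp add: has_field_derivative_def mult.assoc mult.left_commute[of f'])
  show ?thesis
    unfolding radial_connection_def
    by (auto intro!: derivative_eq_intros comp[OF assms(1)] comp[OF assms(2)] comp[OF assms(3)]
        simp: fun_eq_iff algebra_simps)
qed

lemma tangent_space_plane:
  fixes P :: "'a::euclidean_space set"
  assumes S: "open S" and P: "subspace P" and p: "p \<in> S" "p \<in> P"
  shows "tangent_space (S \<inter> P) p = P"
proof (rule subset_antisym; rule subsetI)
  fix d assume "d \<in> tangent_space (S \<inter> P) p"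
  then obtain c :: "real \<Rightarrow> 'a" and e where c: "d = vector_derivative c (at 0)" "0 < e"
    "smooth_on c {-e<..<e}" "c ` {-e<..<e} \<subseteq> S \<inter> P"
    by (auto simp: tangent_space_def)
  have d: "c differentiable (at 0)"
    using smooth_onD(2)[OF c(3), of 0] c(2) by simp
  have "dir_deriv c 0 1 \<in> P"
    using c by (intro dir_deriv_mem_subspace[OF P, of "{-e<..<e}"] d) auto
  then show "d \<in> P"
    by (simp add: dir_deriv_def frechet_derivative_eq_vector_derivative[OF d] c(1))
next
  fix d assume d: "d \<in> P"
  define c where "c t = p + t *\<^sub>R d" for t :: real
  have "continuous_on UNIV c"
    unfolding c_def by (intro continuous_intros)
  then have "open (c -` S)"
    by (rule open_vimage[OF S])
  moreover have "0 \<in> c -` S"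
    using p by (simp add: c_def)
  ultimately obtain e where e: "e > 0" "ball 0 e \<subseteq> c -` S"
    using open_contains_ball by blast
  have "c t \<in> S \<inter> P" if "t \<in> {-e<..<e}" for t
  proof -
    have "t \<in> ball 0 e" using that by (auto simp: dist_real_def)
    then show ?thesis
      using e P p d by (auto simp: c_def subspace_add subspace_mul)
  qed
  moreover have "smooth_on c {-e<..<e}"
    unfolding c_def by (intro smooth_on_affine bounded_linear_scaleR_left) simp
  moreover have "(c has_vector_derivative d) (at 0)"
    unfolding c_def by (auto intro!: derivative_eq_intros)
  then have "d = vector_derivative c (at 0)"
    by (simp add: vector_derivative_at)
  moreover have "c 0 = p" by (simp add: c_def)
  ultimately show "d \<in> tangent_space (S \<inter> P) p"
    unfolding tangent_space_def using e(1) by blast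
qed

context geodesic_plane
begin

text \<open>
  For a rotationally symmetric connection \<open>R(u,v)w\<close> is a combination of three rotation covariant
  vectors, antisymmetric in \<open>u\<close> and \<open>v\<close>, with coefficients \<open>T\<close>, \<open>W\<close> and \<open>Z\<close>. The first condition on
  the coefficients expresses that \<open>R(u,v)\<close> is skew-adjoint for the metric, and the second one then
  identifies \<open>\<kappa>\<close>.
\<close>

lemma curvature_radial:
  assumes conn: "\<And>y u w. y \<in> S \<Longrightarrow> y \<in> P \<Longrightarrow> u \<in> P \<Longrightarrow> w \<in> P \<Longrightarrow> \<Gamma> y u w = radial_connection a b c y u w"
    and p: "p \<in> S" "p \<in> P"
    and metric: "\<And>u w. u \<in> P \<Longrightarrow> w \<in> P \<Longrightarrow> G p u w = q * (u \<bullet> w) + s * ((u \<bullet> p) * (w \<bullet> p))"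
    and deriv: "(a has_real_derivative a') (at (p \<bullet> p))" "(b has_real_derivative b') (at (p \<bullet> p))"
      "(c has_real_derivative c') (at (p \<bullet> p))"
    and N: "N = p \<bullet> p"
    and T: "T = b N - a N + a N * b N * N"
    and W: "W = c N - 2 * a' + (a N)\<^sup>2 + a N * c N * N"
    and Z: "Z = 2 * b' - c N + (b N)\<^sup>2 + b N * c N * N"
    and coeff: "q * W = q * Z + s * T + s * Z * N" "\<kappa> * (q + s * N) = T + W * N"
    and uv: "u \<in> P" "v \<in> P"
  shows "G p (riemann G p u v v) u = \<kappa> * (G p u u * G p v v - (G p u v)\<^sup>2)"
proof -
  have dR: "(\<lambda>p. radial_connection a b c p x w) differentiable (at p)" for x w
    using has_derivative_radial_connection[OF deriv] differentiable_def by blast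
  have d: "dir_deriv (\<lambda>y. \<Gamma> y x w) p z = dir_deriv (\<lambda>y. radial_connection a b c y x w) p z"
    if "x \<in> P" "w \<in> P" "z \<in> P" for x w z
    using p that by (intro dir_deriv_eq_on_subspace[OF subspace_P open_S] differentiable_\<Gamma> dR conn) auto
  define R where "R = riemann G p u v v"
  have R: "R = T *\<^sub>R ((v \<bullet> v) *\<^sub>R u - (u \<bullet> v) *\<^sub>R v)
      + (W * (v \<bullet> p)) *\<^sub>R ((v \<bullet> p) *\<^sub>R u - (u \<bullet> p) *\<^sub>R v)
      + (Z * ((u \<bullet> p) * (v \<bullet> v) - (v \<bullet> p) * (u \<bullet> v))) *\<^sub>R p"
  proof (rule iffD1[OF vector_eq_ldot], rule allI)
    fix t
    note mem = \<Gamma>_P[OF p uv(2,2)] \<Gamma>_P[OF p uv]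
    have \<Gamma>\<Gamma>: "\<Gamma> p u (\<Gamma> p v v) = radial_connection a b c p u (radial_connection a b c p v v)"
      "\<Gamma> p v (\<Gamma> p u v) = radial_connection a b c p v (radial_connection a b c p u v)"
      using conn[OF p uv(1) mem(1)] conn[OF p uv(2) mem(2)] conn[OF p uv(2,2)] conn[OF p uv] by auto
    define x y z k l where "x = u \<bullet> u" and "y = v \<bullet> v" and "z = u \<bullet> v" and "k = u \<bullet> p" and "l = v \<bullet> p"
    have i: "u \<bullet> u = x" "v \<bullet> v = y" "u \<bullet> v = z" "v \<bullet> u = z" "u \<bullet> p = k" "p \<bullet> u = k" "v \<bullet> p = l"
      "p \<bullet> v = l" "p \<bullet> p = N"
      by (simp_all add: x_def y_def z_def k_def l_def N inner_commute)
    show "t \<bullet> R = t \<bullet> (T *\<^sub>R ((v \<bullet> v) *\<^sub>R u - (u \<bullet> v) *\<^sub>R v)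
      + (W * (v \<bullet> p)) *\<^sub>R ((v \<bullet> p) *\<^sub>R u - (u \<bullet> p) *\<^sub>R v)
      + (Z * ((u \<bullet> p) * (v \<bullet> v) - (v \<bullet> p) * (u \<bullet> v))) *\<^sub>R p)"
      unfolding R_def riemann_eq[OF p(1)] d[OF uv(2,2,1)] d[OF uv uv(2)]
        dir_derivI[OF has_derivative_radial_connection[OF deriv]] \<Gamma>\<Gamma> T W Z
      unfolding radial_connection_def inner_add_left inner_add_right inner_diff_right
        inner_scaleR_left inner_scaleR_right i
      by algebra
  qed
  have "R \<in> P"
    unfolding R using subspace_P p uv
    by (intro subspace_add subspace_diff subspace_mul)
  have 1: "(u \<bullet> p)\<^sup>2 * (v \<bullet> v) + (v \<bullet> p)\<^sup>2 * (u \<bullet> u) - 2 * (u \<bullet> p) * (v \<bullet> p) * (u \<bullet> v) =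
    N * ((u \<bullet> u) * (v \<bullet> v) - (u \<bullet> v)\<^sup>2)"
    using plane_gram[OF subspace_P dim_P p(2) uv] by (simp add: N)
  define x y z k l where "x = u \<bullet> u" and "y = v \<bullet> v" and "z = u \<bullet> v" and "k = u \<bullet> p" and "l = v \<bullet> p"
  have iR: "R \<bullet> u = T * (y * x - z * z) + W * l * (l * x - k * z) + Z * (k * y - l * z) * k"
    unfolding R x_def y_def z_def k_def l_def
    by (simp add: inner_add_left inner_diff_left inner_commute[of v u] inner_commute[of p u] inner_commute[of p v])
  have iRp: "R \<bullet> p = T * (y * k - z * l) + Z * (k * y - l * z) * N"
    unfolding R x_def y_def z_def k_def l_def N
    by (simp add: inner_add_left inner_diff_left)
  have F: "k\<^sup>2 * y + l\<^sup>2 * x - 2 * k * l * z = N * (x * y - z\<^sup>2)"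
    using 1 by (simp add: x_def y_def z_def k_def l_def)
  have "G p R u = q * (R \<bullet> u) + s * ((R \<bullet> p) * k)"
    using metric[OF \<open>R \<in> P\<close> uv(1)] by (simp add: k_def)
  also have "\<dots> = q * T * (x * y - z\<^sup>2) + q * W * (k\<^sup>2 * y + l\<^sup>2 * x - 2 * k * l * z)"
    unfolding iR iRp using coeff(1) by algebra
  also have "\<dots> = q * (T + W * N) * (x * y - z\<^sup>2)"
    unfolding F by algebra
  also have "\<dots> = q * \<kappa> * (q + s * N) * (x * y - z\<^sup>2)"
    using coeff(2) by simp
  also have "\<dots> = \<kappa> * (q\<^sup>2 * (x * y - z\<^sup>2) + q * s * (k\<^sup>2 * y + l\<^sup>2 * x - 2 * k * l * z))"
    unfolding F by algebra
  also have "\<dots> = \<kappa> * (G p u u * G p v v - (G p u v)\<^sup>2)"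
    unfolding metric[OF uv(1) uv(1)] metric[OF uv(2) uv(2)] metric[OF uv]
      x_def y_def z_def k_def l_def by algebra
  finally show ?thesis by (simp add: R_def)
qed

text \<open>
  Every local parametrization of the plane region is an immersion into the totally geodesic plane, so
  it sees the ambient curvature; a linear one, built from an orthonormal basis, shows that there is
  one at all.
\<close>

lemma gaussian_curvature_plane:
  assumes p: "p \<in> S" "p \<in> P"
    and R: "\<And>u v. u \<in> P \<Longrightarrow> v \<in> P \<Longrightarrow>
      G p (riemann G p u v v) u = \<kappa> * (G p u u * G p v v - (G p u v)\<^sup>2)"
  shows "gaussian_curvature G (S \<inter> P) p = \<kappa>"
  unfolding gaussian_curvature_def
proof (rule the_equality)
  have dd: "frechet_derivative \<phi> (at x) = dir_deriv \<phi> x" for \<phi> :: "real^2 \<Rightarrow> 'a" and x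
    by (simp add: fun_eq_iff dir_deriv_def)
  have val: "sectional_curvature (pullback \<phi> G) x UNIV = \<kappa>"
    if lp: "local_param (S \<inter> P) U \<phi>" and x: "x \<in> U" "\<phi> x = p" for U \<phi> x
  proof -
    have "openin (top_of_set (S \<inter> P)) (\<phi> ` U)"
      using lp by (simp add: local_param_def)
    then have "\<phi> ` U \<subseteq> S \<inter> P"
      by (rule openin_imp_subset)
    then interpret plane_immersion S G \<Gamma> P U \<phi>
      using lp by unfold_locales (auto simp: local_param_def dd)
    show ?thesis
      using R x by (intro sectional_curvature_pullback) auto
  qed
  show "k = \<kappa>" if "\<exists>U \<phi> x. local_param (S \<inter> P) U \<phi> \<and> x \<in> U \<and> \<phi> x = p \<and>
      k = sectional_curvature (pullback \<phi> G) x UNIV" for k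
    using that val by blast
  obtain e f where ef: "e \<in> P" "f \<in> P" "e \<bullet> e = 1" "f \<bullet> f = 1" "e \<bullet> f = 0"
    "\<And>x. x \<in> P \<Longrightarrow> x = (x \<bullet> e) *\<^sub>R e + (x \<bullet> f) *\<^sub>R f"
    using plane_orthonormal_basis[OF subspace_P dim_P] by metis
  define L :: "real^2 \<Rightarrow> 'a" where "L z = z $ 1 *\<^sub>R e + z $ 2 *\<^sub>R f" for z
  define M :: "'a \<Rightarrow> real^2" where "M y = vector [y \<bullet> e, y \<bullet> f]" for y
  have L: "bounded_linear L"
    unfolding L_def by (intro bounded_linear_add bounded_linear_scaleR_const bounded_linear_vec_nth)
  have M_L: "M (L z) = z" for z
    using ef(3-5) by (simp add: M_def L_def vec_eq_iff forall_2 inner_add_left inner_commute[of f e])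
  have L_M: "L (M y) = y" if "y \<in> P" for y
    using ef(6)[OF that] by (simp add: M_def L_def)
  have LP: "L z \<in> P" for z
    unfolding L_def using ef(1,2) subspace_P by (intro subspace_add subspace_mul)
  have contL: "continuous_on A L" for A
    using L by (rule linear_continuous_on)
  have contM: "continuous_on A M" for A
  proof -
    have "M = (\<lambda>y. \<chi> i. if i = 1 then y \<bullet> e else y \<bullet> f)"
      by (simp add: M_def fun_eq_iff vec_eq_iff forall_2)
    moreover have "continuous_on A (\<lambda>y. if i = 1 then y \<bullet> e else y \<bullet> f)" for i :: 2
      by (cases "i = 1") (auto intro!: continuous_intros)
    ultimately show ?thesis
      by (auto intro: continuous_on_vec_lambda)
  qed
  define U where "U = L -` S"
  have U: "open U"
    unfolding U_def using contL[of UNIV] open_S by (simp add: continuous_on_open_vimage)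
  have im: "L ` U = S \<inter> P"
  proof
    show "S \<inter> P \<subseteq> L ` U"
      using L_M by (metis IntE U_def image_eqI subsetI vimageI2)
  qed (use LP in \<open>auto simp: U_def\<close>)
  have "dir_deriv L x = L" for x
    using dir_derivI[OF bounded_linear_imp_has_derivative[OF L]] by blast
  moreover have "inj L"
    using M_L by (metis injI)
  moreover have "homeomorphism U (L ` U) L M"
    using M_L by (auto simp: homeomorphism_def contL contM image_image)
  moreover have "smooth_on L U"
    using smooth_on_affine[OF L U, of 0] by simp
  ultimately have "local_param (S \<inter> P) U L"
    unfolding local_param_def im by (auto simp: dd)
  moreover have "M p \<in> U" "L (M p) = p"
    using L_M[OF p(2)] p by (auto simp: U_def)
  ultimately show "\<exists>U \<phi> x. local_param (S \<inter> P) U \<phi> \<and> x \<in> U \<and> \<phi> x = p \<and>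
      \<kappa> = sectional_curvature (pullback \<phi> G) x UNIV"
    using val by metis
qed

end

section \<open>The metric g in closed form\<close>

lemma im_units_iff: "q \<in> im_units \<longleftrightarrow> fst q = 0 \<and> snd q \<bullet> snd q = 1"
proof -
  have "q \<in> im_units \<longleftrightarrow> fst q * fst q - snd q \<bullet> snd q = -1 \<and> fst q *\<^sub>R snd q + fst q *\<^sub>R snd q = 0"
    by (simp add: im_units_def qmult_def qone_def prod_eq_iff cross_refl)
  also have "\<dots> \<longleftrightarrow> fst q * fst q - snd q \<bullet> snd q = -1 \<and> (fst q = 0 \<or> snd q = 0)"
    by (simp flip: scaleR_2)
  also have "\<dots> \<longleftrightarrow> fst q = 0 \<and> snd q \<bullet> snd q = 1"
  proof -
    have "fst q * fst q \<noteq> -1"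
      using zero_le_square[of "fst q"] by linarith
    then show ?thesis by auto
  qed
  finally show ?thesis .
qed

lemma qslice_iff:
  assumes "I \<in> im_units"
  shows "q \<in> qslice I \<longleftrightarrow> (\<exists>h. snd q = h *\<^sub>R snd I)"
  using assms unfolding im_units_iff qslice_def qone_def
  by (auto simp: prod_eq_iff)

lemma qslice_perp_iff:
  assumes I: "I \<in> im_units"
  shows "q \<in> (qslice I)\<^sup>\<bottom> \<longleftrightarrow> fst q = 0 \<and> snd q \<bullet> snd I = 0"
proof -
  have orth: "q \<in> (qslice I)\<^sup>\<bottom> \<longleftrightarrow> (\<forall>z. z \<in> qslice I \<longrightarrow> fst z * fst q + snd z \<bullet> snd q = 0)"
    by (auto simp: orthogonal_comp_def orthogonal_def inner_prod_def)
  show ?thesis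
  proof
    assume "q \<in> (qslice I)\<^sup>\<bottom>"
    then have z: "z \<in> qslice I \<Longrightarrow> fst z * fst q + snd z \<bullet> snd q = 0" for z
      using orth by blast
    have "(1, 0) \<in> qslice I" "(0, snd I) \<in> qslice I"
      unfolding qslice_iff[OF I] by (auto intro: exI[of _ 0] exI[of _ 1])
    from z[OF this(1)] z[OF this(2)] show "fst q = 0 \<and> snd q \<bullet> snd I = 0"
      by (simp add: inner_commute)
  next
    assume "fst q = 0 \<and> snd q \<bullet> snd I = 0"
    then show "q \<in> (qslice I)\<^sup>\<bottom>"
      unfolding orth qslice_iff[OF I] by (auto simp: inner_commute)
  qed
qed

lemma qslice_plane:
  assumes I: "I \<in> im_units"
  shows "subspace (qslice I)" "dim (qslice I) = 2"
proof -
  have sp: "qslice I = span {qone, I}"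
    by (simp add: set_eq_iff qslice_def span_insert span_singleton image_iff diff_eq_eq add.commute)
  then show "subspace (qslice I)" by simp
  have "independent {qone, I}"
    using I unfolding im_units_iff
    by (intro pairwise_orthogonal_independent)
      (auto simp: pairwise_def orthogonal_def qone_def inner_prod_def prod_eq_iff)
  moreover have "qone \<noteq> I"
    using I unfolding im_units_iff by (auto simp: qone_def)
  ultimately show "dim (qslice I) = 2"
    unfolding sp by (simp add: dim_eq_card_independent)
qed

lemma qslice_perp_plane:
  assumes I: "I \<in> im_units"
  shows "subspace ((qslice I)\<^sup>\<bottom>)" "dim ((qslice I)\<^sup>\<bottom>) = 2"
proof -
  show "subspace ((qslice I)\<^sup>\<bottom>)"
    by (rule subspace_orthogonal_comp)
  show "dim ((qslice I)\<^sup>\<bottom>) = 2"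
    using dim_subspace_orthogonal_to_vectors[OF qslice_plane(1)[OF I] subspace_UNIV] qslice_plane(2)[OF I]
    by (simp add: orthogonal_comp_def)
qed

lemma qball_iff: "q \<in> qball \<longleftrightarrow> q \<bullet> q < 1"
  by (simp add: qball_def norm_eq_sqrt_inner)

lemma open_qball: "open qball"
proof -
  have "qball = ball 0 1" by (auto simp: qball_def)
  then show ?thesis by (metis open_ball)
qed

lemma disc_section_eq:
  assumes J: "J \<in> im_units"
  shows "disc_section J = qball \<inter> (qslice J)\<^sup>\<bottom>"
proof (rule subset_antisym; rule subsetI)
  fix q assume "q \<in> disc_section J"
  then obtain r I where q: "q = r *\<^sub>R I" "0 \<le> r" "r < 1" "I \<in> im_units" "I \<in> (qslice J)\<^sup>\<bottom>"
    by (auto simp: disc_section_def great_circle_def)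
  have "norm I = 1"
    using q(4) by (simp add: norm_eq_1 im_units_iff inner_prod_def)
  then have "q \<in> qball"
    using q by (simp add: qball_def)
  then show "q \<in> qball \<inter> (qslice J)\<^sup>\<bottom>"
    using q subspace_orthogonal_comp[of "qslice J"] by (simp add: subspace_mul)
next
  fix q assume q: "q \<in> qball \<inter> (qslice J)\<^sup>\<bottom>"
  have unit: "I \<in> great_circle J" if "I \<in> (qslice J)\<^sup>\<bottom>" "I \<bullet> I = 1" for I
    using that qslice_perp_iff[OF J] by (simp add: great_circle_def im_units_iff inner_prod_def)
  show "q \<in> disc_section J"
  proof (cases "q = 0")
    case True
    obtain e where "e \<in> (qslice J)\<^sup>\<bottom>" "e \<bullet> e = 1"
      using plane_orthonormal_basis[OF qslice_perp_plane[OF J]] by metis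
    then have "e \<in> great_circle J"
      by (rule unit)
    then show ?thesis
      unfolding disc_section_def True by (intro CollectI exI[of _ 0] exI[of _ e]) simp
  next
    case False
    have "(q /\<^sub>R norm q) \<bullet> (q /\<^sub>R norm q) = 1"
      unfolding norm_eq_1[symmetric] using False by simp
    moreover have "q /\<^sub>R norm q \<in> (qslice J)\<^sup>\<bottom>"
      using q by (intro subspace_mul subspace_orthogonal_comp) simp
    ultimately have "(q /\<^sub>R norm q) \<in> great_circle J"
      by (intro unit)
    moreover have "q = norm q *\<^sub>R (q /\<^sub>R norm q)"
      using False by simp
    moreover have "norm q < 1"
      using q by (simp add: qball_def)
    ultimately show ?thesis
      unfolding disc_section_def using norm_ge_zero by blast
  qed
qed

text \<open>
  These two are the denominators of \<open>g\<close> on the slice through the point and on its orthogonal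
  complement; the second one is \<open>\<bar>1 - p\<^sup>2\<bar>\<^sup>2\<close>.
\<close>

definition slice_weight :: "quat \<Rightarrow> real" where
  "slice_weight p = (1 - p \<bullet> p)\<^sup>2"

definition normal_weight :: "quat \<Rightarrow> real" where
  "normal_weight p = slice_weight p + 4 * (snd p \<bullet> snd p)"

definition g_form :: "quat metric_field" where
  "g_form p u w = fst u * fst w / slice_weight p + snd u \<bullet> snd w / normal_weight p
     + 4 * (snd u \<bullet> snd p) * (snd w \<bullet> snd p) / (slice_weight p * normal_weight p)"

lemma slice_weight_pos: "p \<in> qball \<Longrightarrow> 0 < slice_weight p"
  by (simp add: slice_weight_def qball_iff)

lemma normal_weight_pos: "p \<in> qball \<Longrightarrow> 0 < normal_weight p"
  using slice_weight_pos[of p] by (simp add: normal_weight_def add_pos_nonneg)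

text \<open>
  With \<open>v = y I\<close> and \<open>d\<^sub>1 = (a, b I)\<close> both sides agree by \<open>b\<^sup>2 / B + 4 b\<^sup>2 y\<^sup>2 / (A B) = b\<^sup>2 / A\<close>. The
  computation works for each admissible unit \<open>I\<close>, also at real points, where \<open>y = 0\<close> and \<open>I\<close> is
  arbitrary.
\<close>

lemma g_normsq_eq:
  assumes w: "w \<in> qball"
  shows "g_normsq w d = g_form w d d"
  unfolding g_normsq_def
proof (rule the_equality)
  have nsq: "(norm q)\<^sup>2 = (fst q)\<^sup>2 + snd q \<bullet> snd q" for q :: quat
    unfolding power2_norm_eq_inner inner_prod_def by (simp add: power2_eq_square)
  have val: "(norm d1)\<^sup>2 / (1 - (norm w)\<^sup>2)\<^sup>2 + (norm d2)\<^sup>2 / (norm (qone - qmult w w))\<^sup>2 = g_form w d d"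
    if I: "I \<in> im_units" and wI: "w \<in> qslice I" and d: "d1 \<in> qslice I" "d2 \<in> (qslice I)\<^sup>\<bottom>" "d = d1 + d2"
    for I d1 d2
  proof -
    obtain y where y: "snd w = y *\<^sub>R snd I"
      using wI qslice_iff[OF I] by blast
    obtain b where b: "snd d1 = b *\<^sub>R snd I"
      using d(1) qslice_iff[OF I] by blast
    have i: "snd I \<bullet> snd I = 1"
      using I by (simp add: im_units_iff)
    have d2: "fst d2 = 0" "snd d2 \<bullet> snd I = 0" "snd I \<bullet> snd d2 = 0"
      using d(2) qslice_perp_iff[OF I] by (auto simp: inner_commute)
    have A: "(1 - (norm w)\<^sup>2)\<^sup>2 = slice_weight w"
      by (simp add: slice_weight_def power2_norm_eq_inner)
    have "(norm (qone - qmult w w))\<^sup>2 = (1 - (fst w)\<^sup>2 + y\<^sup>2)\<^sup>2 + 4 * (fst w)\<^sup>2 * y\<^sup>2"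
    proof -
      have "fst (qone - qmult w w) = 1 - (fst w)\<^sup>2 + y\<^sup>2"
        "snd (qone - qmult w w) = (- 2 * fst w * y) *\<^sub>R snd I"
        by (simp_all add: qone_def qmult_def y i cross_refl power2_eq_square flip: scaleR_2)
      then show ?thesis
        unfolding nsq by (simp add: i power2_eq_square)
    qed
    also have "\<dots> = normal_weight w"
      by (simp add: normal_weight_def slice_weight_def inner_prod_def y i) algebra
    finally have B: "(norm (qone - qmult w w))\<^sup>2 = normal_weight w" .
    have BA: "normal_weight w = slice_weight w + 4 * y\<^sup>2"
      by (simp add: normal_weight_def y i power2_eq_square)
    have "g_form w d d = (fst d1)\<^sup>2 / slice_weight w + (b\<^sup>2 + snd d2 \<bullet> snd d2) / normal_weight w + 4 * (b * y)\<^sup>2 / (slice_weight w * normal_weight w)"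
      by (simp add: g_form_def d(3) d2 b y i inner_add_left inner_add_right power2_eq_square)
    also have "\<dots> = ((fst d1)\<^sup>2 + b\<^sup>2) / slice_weight w + (snd d2 \<bullet> snd d2) / normal_weight w"
    proof -
      have "b\<^sup>2 / normal_weight w + 4 * (b * y)\<^sup>2 / (slice_weight w * normal_weight w) = b\<^sup>2 * (slice_weight w + 4 * y\<^sup>2) / (slice_weight w * normal_weight w)"
        using slice_weight_pos[OF w] normal_weight_pos[OF w] by (simp add: field_simps)
      also have "\<dots> = b\<^sup>2 / slice_weight w"
        using normal_weight_pos[OF w] by (simp flip: BA)
      finally show ?thesis
        by (simp add: add_divide_distrib)
    qed
    finally show ?thesis
      unfolding A B nsq[of d1] nsq[of d2] by (simp add: d2 b i power2_eq_square)
  qed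
  have "\<exists>I \<in> im_units. w \<in> qslice I"
  proof (cases "snd w = 0")
    case True
    obtain i :: "real^3" where "i \<bullet> i = 1"
      using vector_choose_size[of 1] norm_eq_1 by (metis zero_le_one)
    then have "(0, i) \<in> im_units"
      by (simp add: im_units_iff)
    then show ?thesis
      using True qslice_iff by (metis scaleR_zero_left)
  next
    case False
    have I: "(0, snd w /\<^sub>R norm (snd w)) \<in> im_units"
      unfolding im_units_iff norm_eq_1[symmetric] snd_conv using False by simp
    then have "w \<in> qslice (0, snd w /\<^sub>R norm (snd w))"
      unfolding qslice_iff[OF I] using False by (intro exI[of _ "norm (snd w)"]) simp
    with I show ?thesis by blast
  qed
  then obtain I where I: "I \<in> im_units" "w \<in> qslice I" by blast
  define d1 :: quat where "d1 = (fst d, (snd d \<bullet> snd I) *\<^sub>R snd I)"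
  have "d1 \<in> qslice I" "d - d1 \<in> (qslice I)\<^sup>\<bottom>"
    unfolding qslice_iff[OF I(1)] qslice_perp_iff[OF I(1)] using I(1)
    by (auto simp: d1_def im_units_iff inner_diff_left)
  moreover have "d = d1 + (d - d1)" by simp
  ultimately show "\<exists>I d1 d2. I \<in> im_units \<and> w \<in> qslice I \<and> d1 \<in> qslice I \<and> d2 \<in> (qslice I)\<^sup>\<bottom> \<and> d = d1 + d2 \<and>
      g_form w d d = (norm d1)\<^sup>2 / (1 - (norm w)\<^sup>2)\<^sup>2 + (norm d2)\<^sup>2 / (norm (qone - qmult w w))\<^sup>2"
    using val I by metis
  show "r = g_form w d d" if "\<exists>I d1 d2. I \<in> im_units \<and> w \<in> qslice I \<and> d1 \<in> qslice I \<and> d2 \<in> (qslice I)\<^sup>\<bottom> \<and>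
      d = d1 + d2 \<and> r = (norm d1)\<^sup>2 / (1 - (norm w)\<^sup>2)\<^sup>2 + (norm d2)\<^sup>2 / (norm (qone - qmult w w))\<^sup>2" for r
    using that val by blast
qed

lemma g_metric_eq:
  assumes "w \<in> qball"
  shows "g_metric w u v = g_form w u v"
  unfolding g_metric_def g_normsq_eq[OF assms] g_form_def
  by (simp add: inner_add_left inner_diff_left inner_add_right inner_diff_right inner_commute[of "snd v" "snd u"]
      add_divide_distrib diff_divide_distrib algebra_simps)

section \<open>The Levi-Civita connection of g\<close>

definition grad_slice_weight :: "quat \<Rightarrow> quat" where
  "grad_slice_weight p = (- 4 * (1 - p \<bullet> p)) *\<^sub>R p"

definition grad_normal_weight :: "quat \<Rightarrow> quat" where
  "grad_normal_weight p = grad_slice_weight p + (0, 8 *\<^sub>R snd p)"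

text \<open>
  The next three are the gradients of the coefficients \<open>1/A\<close>, \<open>1/B\<close> and \<open>4/(A B)\<close> of the closed form of \<open>g\<close>.
\<close>

definition grad_real_coeff :: "quat \<Rightarrow> quat" where
  "grad_real_coeff p = (- 1 / (slice_weight p)\<^sup>2) *\<^sub>R grad_slice_weight p"

definition grad_imag_coeff :: "quat \<Rightarrow> quat" where
  "grad_imag_coeff p = (- 1 / (normal_weight p)\<^sup>2) *\<^sub>R grad_normal_weight p"

definition grad_radial_coeff :: "quat \<Rightarrow> quat" where
  "grad_radial_coeff p = (- 4 / (slice_weight p * normal_weight p)\<^sup>2) *\<^sub>R (slice_weight p *\<^sub>R grad_normal_weight p + normal_weight p *\<^sub>R grad_slice_weight p)"

lemma slice_weight_deriv: "(slice_weight has_derivative (\<lambda>u. grad_slice_weight p \<bullet> u)) (at p)"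
  unfolding slice_weight_def[abs_def]
  by (auto intro!: derivative_eq_intros simp: grad_slice_weight_def inner_commute algebra_simps)

lemma normal_weight_deriv: "(normal_weight has_derivative (\<lambda>u. grad_normal_weight p \<bullet> u)) (at p)"
  unfolding normal_weight_def[abs_def]
  by (auto intro!: derivative_eq_intros slice_weight_deriv simp: grad_normal_weight_def inner_commute inner_add_left inner_prod_def algebra_simps)

lemma coeff_deriv:
  assumes "p \<in> qball"
  shows "((\<lambda>p. 1 / slice_weight p) has_derivative (\<lambda>u. grad_real_coeff p \<bullet> u)) (at p)"
    "((\<lambda>p. 1 / normal_weight p) has_derivative (\<lambda>u. grad_imag_coeff p \<bullet> u)) (at p)"
    "((\<lambda>p. 4 / (slice_weight p * normal_weight p)) has_derivative (\<lambda>u. grad_radial_coeff p \<bullet> u)) (at p)"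
proof -
  note pos = slice_weight_pos[OF assms] normal_weight_pos[OF assms]
  show "((\<lambda>p. 1 / slice_weight p) has_derivative (\<lambda>u. grad_real_coeff p \<bullet> u)) (at p)"
    "((\<lambda>p. 1 / normal_weight p) has_derivative (\<lambda>u. grad_imag_coeff p \<bullet> u)) (at p)"
    using pos by (auto intro!: derivative_eq_intros slice_weight_deriv normal_weight_deriv
      simp: grad_real_coeff_def grad_imag_coeff_def power2_eq_square field_simps)
  have "((\<lambda>p. 4 / (slice_weight p * normal_weight p)) has_derivative
      (\<lambda>u. (- 4 / (slice_weight p * normal_weight p)\<^sup>2) * (slice_weight p * (grad_normal_weight p \<bullet> u) + normal_weight p * (grad_slice_weight p \<bullet> u)))) (at p)"
    using pos by (auto intro!: derivative_eq_intros slice_weight_deriv normal_weight_deriv simp: power2_eq_square field_simps)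
  then show "((\<lambda>p. 4 / (slice_weight p * normal_weight p)) has_derivative (\<lambda>u. grad_radial_coeff p \<bullet> u)) (at p)"
    by (simp only: grad_radial_coeff_def inner_scaleR_left inner_add_left)
qed

text \<open>
  The right-hand side of the Koszul formula, represented with respect to the Euclidean inner product.
\<close>

definition koszul_vector :: "quat \<Rightarrow> quat \<Rightarrow> quat \<Rightarrow> quat" where
  "koszul_vector p u w = (1/2) *\<^sub>R (
      ((grad_real_coeff p \<bullet> u) * fst w + (grad_real_coeff p \<bullet> w) * fst u,
       (grad_imag_coeff p \<bullet> u) *\<^sub>R snd w + (grad_imag_coeff p \<bullet> w) *\<^sub>R snd u
       + ((grad_radial_coeff p \<bullet> u) * (snd w \<bullet> snd p) + (grad_radial_coeff p \<bullet> w) * (snd u \<bullet> snd p)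
          + 8 / (slice_weight p * normal_weight p) * (snd u \<bullet> snd w)) *\<^sub>R snd p)
      - ((fst u * fst w) *\<^sub>R grad_real_coeff p + (snd u \<bullet> snd w) *\<^sub>R grad_imag_coeff p
         + ((snd u \<bullet> snd p) * (snd w \<bullet> snd p)) *\<^sub>R grad_radial_coeff p))"

text \<open>
  The inverse of the Gram operator of \<open>g\<close>. On imaginary parts, inverting the rank-one perturbation
  \<open>(1/B) id + (4/(A B)) v v\<^sup>T\<close> gives \<open>B id - 4 v v\<^sup>T\<close>, because \<open>B - 4 \<bar>v\<bar>\<^sup>2 = A\<close>.
\<close>

definition sharp :: "quat \<Rightarrow> quat \<Rightarrow> quat" where
  "sharp p e = (slice_weight p * fst e, normal_weight p *\<^sub>R snd e - (4 * (snd e \<bullet> snd p)) *\<^sub>R snd p)"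

definition g_connection :: "quat \<Rightarrow> quat \<Rightarrow> quat \<Rightarrow> quat" where
  "g_connection p u w = sharp p (koszul_vector p u w)"

lemma g_form_sharp:
  assumes "p \<in> qball" shows "g_form p (sharp p e) z = e \<bullet> z"
proof -
  define k l n where "k = snd e \<bullet> snd p" and "l = snd z \<bullet> snd p" and "n = snd p \<bullet> snd p"
  have i: "snd e \<bullet> snd p = k" "snd z \<bullet> snd p = l" "snd p \<bullet> snd z = l" "snd p \<bullet> snd p = n"
    by (simp_all add: k_def l_def n_def inner_commute)
  have A: "slice_weight p \<noteq> 0" and B: "normal_weight p \<noteq> 0"
    using slice_weight_pos[OF assms] normal_weight_pos[OF assms] by auto
  have BA: "normal_weight p * k - 4 * k * n = slice_weight p * k"
    by (simp add: normal_weight_def n_def algebra_simps)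
  have "g_form p (sharp p e) z = fst e * fst z + (normal_weight p * (snd e \<bullet> snd z) - 4 * k * l) / normal_weight p
      + 4 * (normal_weight p * k - 4 * k * n) * l / (slice_weight p * normal_weight p)"
    using A by (simp add: g_form_def sharp_def inner_diff_left i)
  also have "\<dots> = fst e * fst z + snd e \<bullet> snd z"
    unfolding BA using A B by (simp add: field_simps)
  finally show ?thesis
    by (simp add: inner_prod_def)
qed

lemma g_form_deriv:
  assumes "p \<in> qball"
  shows "((\<lambda>p. g_form p v w) has_derivative (\<lambda>u. (grad_real_coeff p \<bullet> u) * (fst v * fst w)
     + (grad_imag_coeff p \<bullet> u) * (snd v \<bullet> snd w) + (grad_radial_coeff p \<bullet> u) * ((snd v \<bullet> snd p) * (snd w \<bullet> snd p))
     + 4 / (slice_weight p * normal_weight p) * ((snd v \<bullet> snd u) * (snd w \<bullet> snd p) + (snd v \<bullet> snd p) * (snd w \<bullet> snd u)))) (at p)"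
proof -
  have eq: "g_form p v w = (1 / slice_weight p) * (fst v * fst w) + (1 / normal_weight p) * (snd v \<bullet> snd w)
      + (4 / (slice_weight p * normal_weight p)) * ((snd v \<bullet> snd p) * (snd w \<bullet> snd p))" for p
    by (simp add: g_form_def)
  have "((\<lambda>p. f p * a + g p * b + h p * ((snd v \<bullet> snd p) * (snd w \<bullet> snd p))) has_derivative
      (\<lambda>u. f' u * a + g' u * b + h' u * ((snd v \<bullet> snd p) * (snd w \<bullet> snd p))
        + h p * ((snd v \<bullet> snd u) * (snd w \<bullet> snd p) + (snd v \<bullet> snd p) * (snd w \<bullet> snd u)))) (at p)"
    if "(f has_derivative f') (at p)" "(g has_derivative g') (at p)" "(h has_derivative h') (at p)"
    for f g h f' g' h' a b
    using that by (auto intro!: derivative_eq_intros simp: algebra_simps)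
  from this[OF coeff_deriv[OF assms]] show ?thesis
    unfolding eq .
qed

lemma g_connection_koszul:
  assumes p: "p \<in> qball"
  shows "g_form p (g_connection p u v) w =
        (dir_deriv (\<lambda>y. g_form y v w) p u + dir_deriv (\<lambda>y. g_form y u w) p v
          - dir_deriv (\<lambda>y. g_form y u v) p w) / 2"
proof -
  have pair: "(a, b) \<bullet> z = a * fst z + b \<bullet> snd z" for a :: real and b :: "real^3" and z
    by (simp add: inner_prod_def)
  show ?thesis
    unfolding g_connection_def g_form_sharp[OF p] dir_derivI[OF g_form_deriv[OF p]] koszul_vector_def
      inner_scaleR_left inner_diff_left inner_add_left pair
    by (simp add: inner_commute algebra_simps)
qed

lemma differentiable_gconn:
  assumes p: "p \<in> qball"
  shows "(\<lambda>p. g_connection p u w) differentiable (at p)"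
proof -
  have A: "slice_weight p \<noteq> 0" and B: "normal_weight p \<noteq> 0"
    using slice_weight_pos[OF p] normal_weight_pos[OF p] by auto
  have dA: "slice_weight differentiable (at p)" and dB: "normal_weight differentiable (at p)"
    using slice_weight_deriv normal_weight_deriv differentiable_def by blast+
  have ds: "(\<lambda>p. snd (f p)) differentiable (at p)" "(\<lambda>p. fst (f p)) differentiable (at p)"
    if "f differentiable (at p)" for f :: "quat \<Rightarrow> quat"
    using that unfolding differentiable_def by (blast intro: has_derivative_snd has_derivative_fst)+
  have dgA: "grad_slice_weight differentiable (at p)"
    unfolding grad_slice_weight_def[abs_def]
    by (intro differentiable_scaleR differentiable_mult differentiable_diff differentiable_inner
        differentiable_const differentiable_ident)
  have dgB: "grad_normal_weight differentiable (at p)"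
    unfolding grad_normal_weight_def[abs_def]
    by (intro differentiable_add dgA differentiable_Pair differentiable_scaleR
        differentiable_const differentiable_ident ds)
  have dre: "grad_real_coeff differentiable (at p)"
    unfolding grad_real_coeff_def[abs_def] using A
    by (intro differentiable_scaleR differentiable_divide differentiable_power differentiable_const dgA dA) auto
  have dim: "grad_imag_coeff differentiable (at p)"
    unfolding grad_imag_coeff_def[abs_def] using B
    by (intro differentiable_scaleR differentiable_divide differentiable_power differentiable_const dgB dB) auto
  have dmix: "grad_radial_coeff differentiable (at p)"
    unfolding grad_radial_coeff_def[abs_def] using A B
    by (intro differentiable_scaleR differentiable_divide differentiable_power differentiable_mult
        differentiable_add differentiable_const dgB dB dgA dA) auto
  have dl: "(\<lambda>p. koszul_vector p u w) differentiable (at p)"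
    unfolding koszul_vector_def using A B
    by (intro differentiable_scaleR differentiable_divide differentiable_mult differentiable_Pair
        differentiable_inner differentiable_diff
        differentiable_add differentiable_const dB dA dre dim dmix ds differentiable_ident) auto
  show ?thesis
    unfolding g_connection_def sharp_def
    by (intro differentiable_scaleR differentiable_mult differentiable_Pair
        differentiable_inner differentiable_diff
        differentiable_const dB dA ds dl differentiable_ident)
qed

lemma bilinear_gconn: "bilinear (g_connection p)"
proof -
  have low: "koszul_vector p (u + u') w = koszul_vector p u w + koszul_vector p u' w"
    "koszul_vector p (c *\<^sub>R u) w = c *\<^sub>R koszul_vector p u w"
    "koszul_vector p w (u + u') = koszul_vector p w u + koszul_vector p w u'"
    "koszul_vector p w (c *\<^sub>R u) = c *\<^sub>R koszul_vector p w u" for u u' w c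
    unfolding koszul_vector_def by (simp_all add: prod_eq_iff inner_add_left inner_add_right add_divide_distrib algebra_simps)
  have rai: "sharp p (e + e') = sharp p e + sharp p e'" "sharp p (c *\<^sub>R e) = c *\<^sub>R sharp p e" for e e' c
    unfolding sharp_def by (simp_all add: prod_eq_iff inner_add_left algebra_simps)
  show ?thesis
    unfolding bilinear_def g_connection_def by (intro conjI allI linearI) (simp_all only: low rai)
qed

lemma levi_civita_g: "levi_civita qball g_metric g_connection"
proof
  show "open qball" by (rule open_qball)
  fix y :: quat assume y: "y \<in> qball"
  note A = slice_weight_pos[OF y] and B = normal_weight_pos[OF y]
  have d: "dir_deriv (\<lambda>y. g_metric y a b) y z = dir_deriv (\<lambda>y. g_form y a b) y z" for a b z
    by (rule dir_deriv_cong[OF open_qball y]) (rule g_metric_eq)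
  show "bilinear (g_metric y)"
    unfolding bilinear_def g_metric_eq[OF y] g_form_def
    by (auto intro!: linearI simp: inner_add_left inner_add_right add_divide_distrib algebra_simps)
  show "g_metric y u v = g_metric y v u" for u v
    by (simp add: g_metric_eq[OF y] g_form_def inner_commute mult_ac)
  show "0 < g_metric y v v" if "v \<noteq> 0" for v
  proof -
    have "0 < fst v * fst v / slice_weight y + snd v \<bullet> snd v / normal_weight y"
    proof (cases "fst v = 0")
      case True
      then have "snd v \<noteq> 0" using that by (simp add: prod_eq_iff)
      then show ?thesis using True B by simp
    next
      case False
      then have "0 < fst v * fst v"
        using zero_less_power2[of "fst v"] by (simp add: power2_eq_square)
      then show ?thesis using A B by (intro add_pos_nonneg) auto
    qed
    then show ?thesis
      using A B by (simp add: g_metric_eq[OF y] g_form_def mult.assoc add_pos_nonneg)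
  qed
  show "(\<lambda>y. g_metric y u v) differentiable at y" for u v
  proof (rule differentiable_cong_open[OF open_qball y])
    show "(\<lambda>y. g_form y u v) differentiable at y"
      using g_form_deriv[OF y] unfolding differentiable_def by blast
  qed (simp add: g_metric_eq)
  show "bilinear (g_connection y)" by (rule bilinear_gconn)
  show "(\<lambda>y. g_connection y u v) differentiable at y" for u v
    by (rule differentiable_gconn[OF y])
  show "g_metric y (g_connection y u v) w = (dir_deriv (\<lambda>y. g_metric y v w) y u + dir_deriv (\<lambda>y. g_metric y u w) y v
          - dir_deriv (\<lambda>y. g_metric y u v) y w) / 2" for u v w
    unfolding d g_metric_eq[OF y] by (rule g_connection_koszul[OF y])
qed

section \<open>Curvature of slices and of orthogonal discs\<close>

text \<open>
  On the plane orthogonal to a slice the real parts vanish, and \<open>A = (1 - n)\<^sup>2\<close> and \<open>B = (1 + n)\<^sup>2\<close> for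
  \<open>n = \<bar>p\<bar>\<^sup>2\<close>, so all gradients are multiples of \<open>p\<close>.
\<close>

lemma g_connection_perp:
  assumes J: "J \<in> im_units" and p: "p \<in> qball"
    and P: "p \<in> (qslice J)\<^sup>\<bottom>" "u \<in> (qslice J)\<^sup>\<bottom>" "w \<in> (qslice J)\<^sup>\<bottom>"
  shows "g_connection p u w = radial_connection (\<lambda>n. - 2 / (1 + n)) (\<lambda>n. (6 + 2 * n\<^sup>2) / (1 + n) ^ 3)
    (\<lambda>n. 16 / ((1 - n) * (1 + n) ^ 3)) p u w"
proof -
  define n k l z where "n = p \<bullet> p" and "k = snd u \<bullet> snd p" and "l = snd w \<bullet> snd p" and "z = snd u \<bullet> snd w"
  have f: "fst p = 0" "fst u = 0" "fst w = 0"
    using P qslice_perp_iff[OF J] by auto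
  have i: "p \<bullet> p = n" "snd p \<bullet> snd p = n" "u \<bullet> p = k" "w \<bullet> p = l" "p \<bullet> u = k" "p \<bullet> w = l" "u \<bullet> w = z"
    "snd u \<bullet> snd p = k" "snd w \<bullet> snd p = l" "snd u \<bullet> snd w = z"
    by (simp_all add: n_def k_def l_def z_def f inner_prod_def inner_commute)
  have n: "0 \<le> n" "n < 1"
    using p by (auto simp: n_def qball_iff)
  define s t where "s = 1 - n" and "t = 1 + n"
  have st: "s > 0" "t > 0" using n by (auto simp: s_def t_def)
  have A: "slice_weight p = s\<^sup>2" and B: "normal_weight p = t\<^sup>2"
    by (simp_all add: slice_weight_def normal_weight_def i s_def t_def) algebra
  have gA: "grad_slice_weight p = (- 4 * s) *\<^sub>R p"
    by (simp add: grad_slice_weight_def i s_def)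
  have "(0, 8 *\<^sub>R snd p) = 8 *\<^sub>R p"
    by (simp add: prod_eq_iff f)
  then have "grad_normal_weight p = (- 4 * s + 8) *\<^sub>R p"
    unfolding grad_normal_weight_def gA by (simp only: scaleR_left_distrib)
  then have gB: "grad_normal_weight p = (4 * t) *\<^sub>R p"
    by (simp add: s_def t_def)
  define q r where "q = - 4 / t ^ 3" and "r = 32 * n / (s * t) ^ 3"
  have gi: "grad_imag_coeff p = q *\<^sub>R p"
    using st by (simp add: grad_imag_coeff_def gB B q_def field_simps eval_nat_numeral)
  have "(- 4 / (s\<^sup>2 * t\<^sup>2)\<^sup>2) * (s\<^sup>2 * (4 * t) + t\<^sup>2 * (- 4 * s)) = r"
  proof -
    have eq: "s\<^sup>2 * (4 * t) + t\<^sup>2 * (- 4 * s) = - 8 * n * (s * t)"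
      by (simp add: s_def t_def) algebra
    show ?thesis
      unfolding eq using st by (simp add: r_def field_simps eval_nat_numeral)
  qed
  then have gm: "grad_radial_coeff p = r *\<^sub>R p"
    by (simp only: grad_radial_coeff_def gA gB A B scaleR_scaleR flip: scaleR_left_distrib)
  define c where "c = 4 / (s\<^sup>2 * t\<^sup>2)"
  have c: "8 / (s\<^sup>2 * t\<^sup>2) = 2 * c"
    by (simp add: c_def)
  define m where "m = r * k * l / 2 + c * z - q * z / 2"
  have low: "koszul_vector p u w = (0, (q * k / 2) *\<^sub>R snd w + (q * l / 2) *\<^sub>R snd u + m *\<^sub>R snd p)"
  proof (rule prod_eqI)
    have L: "v \<bullet> snd (koszul_vector p u w) = v \<bullet> ((q * k / 2) *\<^sub>R snd w + (q * l / 2) *\<^sub>R snd u + m *\<^sub>R snd p)" for v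
      unfolding koszul_vector_def gi gm A B c f i m_def snd_scaleR snd_diff snd_add snd_conv
        inner_scaleR_right inner_scaleR_left inner_add_right inner_diff_right
      by (simp add: algebra_simps)
    show "snd (koszul_vector p u w) = snd (0::real, (q * k / 2) *\<^sub>R snd w + (q * l / 2) *\<^sub>R snd u + m *\<^sub>R snd p)"
      unfolding snd_conv by (rule iffD1[OF vector_eq_ldot], rule allI, rule L)
  qed (simp add: koszul_vector_def gi gm f)
  have c1: "t\<^sup>2 * (q / 2) = - 2 / t"
    using st by (simp add: q_def field_simps eval_nat_numeral)
  have "s\<^sup>2 * (r / 2) - 4 * q = 16 * (n + s) / (s * t ^ 3)"
    using st by (simp add: r_def q_def field_simps eval_nat_numeral)
  then have c2: "s\<^sup>2 * (r / 2) - 4 * q = 16 / (s * t ^ 3)"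
    by (simp add: s_def)
  have "s\<^sup>2 * (c - q / 2) = (4 * t + 2 * s\<^sup>2) / t ^ 3"
    using st by (simp add: c_def q_def field_simps eval_nat_numeral)
  also have "4 * t + 2 * s\<^sup>2 = 6 + 2 * n\<^sup>2"
    by (simp add: s_def t_def) algebra
  finally have c3: "s\<^sup>2 * (c - q / 2) = (6 + 2 * n\<^sup>2) / t ^ 3" .
  have ts: "t\<^sup>2 = s\<^sup>2 + 4 * n"
    by (simp add: s_def t_def) algebra
  have c4: "t\<^sup>2 * m - 4 * (q * k * l + m * n) = (6 + 2 * n\<^sup>2) / t ^ 3 * z + 16 / (s * t ^ 3) * (k * l)"
    unfolding c2[symmetric] c3[symmetric] m_def ts by algebra
  have "t\<^sup>2 *\<^sub>R ((q * k / 2) *\<^sub>R snd w + (q * l / 2) *\<^sub>R snd u + m *\<^sub>R snd p)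
      - (4 * (((q * k / 2) *\<^sub>R snd w + (q * l / 2) *\<^sub>R snd u + m *\<^sub>R snd p) \<bullet> snd p)) *\<^sub>R snd p
    = (t\<^sup>2 * (q / 2)) *\<^sub>R (k *\<^sub>R snd w + l *\<^sub>R snd u) + (t\<^sup>2 * m - 4 * (q * k * l + m * n)) *\<^sub>R snd p"
  proof (rule iffD1[OF vector_eq_ldot], rule allI)
    fix v
    show "v \<bullet> (t\<^sup>2 *\<^sub>R ((q * k / 2) *\<^sub>R snd w + (q * l / 2) *\<^sub>R snd u + m *\<^sub>R snd p)
      - (4 * (((q * k / 2) *\<^sub>R snd w + (q * l / 2) *\<^sub>R snd u + m *\<^sub>R snd p) \<bullet> snd p)) *\<^sub>R snd p)
    = v \<bullet> ((t\<^sup>2 * (q / 2)) *\<^sub>R (k *\<^sub>R snd w + l *\<^sub>R snd u) + (t\<^sup>2 * m - 4 * (q * k * l + m * n)) *\<^sub>R snd p)"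
      unfolding inner_scaleR_right inner_scaleR_left inner_add_right inner_diff_right inner_add_left i
      by (simp add: algebra_simps)
  qed
  then have "snd (g_connection p u w) = (- 2 / t) *\<^sub>R (k *\<^sub>R snd w + l *\<^sub>R snd u)
      + ((6 + 2 * n\<^sup>2) / t ^ 3 * z + 16 / (s * t ^ 3) * (k * l)) *\<^sub>R snd p"
    unfolding g_connection_def sharp_def low B snd_conv c1 c4 .
  moreover have "fst (g_connection p u w) = 0"
    by (simp add: g_connection_def sharp_def low)
  ultimately show ?thesis
    by (simp add: radial_connection_def i prod_eq_iff f s_def t_def scaleR_left_distrib)
qed

text \<open>
  On a slice the imaginary coefficients recombine: for a point with imaginary part \<open>h I\<close>, the function
  \<open>1/B + 4 h\<^sup>2/(A B)\<close> is \<open>1/A\<close>. The derivative of this identity (\<open>key\<close> below) reduces the connection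
  to that of the conformal metric \<open>\<bar>d\<bar>\<^sup>2 / A\<close>.
\<close>

lemma g_connection_slice:
  assumes I: "I \<in> im_units" and p: "p \<in> qball"
    and P: "p \<in> qslice I" "u \<in> qslice I" "w \<in> qslice I"
  shows "g_connection p u w = radial_connection (\<lambda>n. 2 / (1 - n)) (\<lambda>n. - 2 / (1 - n)) (\<lambda>n. 0) p u w"
proof -
  obtain h u1 w1 where h: "snd p = h *\<^sub>R snd I" "snd u = u1 *\<^sub>R snd I" "snd w = w1 *\<^sub>R snd I"
    using P qslice_iff[OF I] by auto
  have i: "snd I \<bullet> snd I = 1"
    using I by (simp add: im_units_iff)
  define x u0 w0 where "x = fst p" and "u0 = fst u" and "w0 = fst w"
  note f = x_def[symmetric] u0_def[symmetric] w0_def[symmetric]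
  define n where "n = p \<bullet> p"
  define s where "s = 1 - n"
  have s: "s > 0"
    using p by (simp add: s_def n_def qball_iff)
  define A B where "A = slice_weight p" and "B = normal_weight p"
  have A: "A = s\<^sup>2"
    by (simp add: A_def slice_weight_def s_def n_def)
  have B: "B = A + 4 * h\<^sup>2"
    by (simp add: A_def B_def normal_weight_def h i power2_eq_square)
  have pos: "A > 0" "B > 0"
    using slice_weight_pos[OF p] normal_weight_pos[OF p] by (auto simp: A_def B_def)
  have gA: "grad_slice_weight p = (- 4 * s) *\<^sub>R p"
    by (simp add: grad_slice_weight_def s_def n_def)
  have pu: "p \<bullet> v = x * fst v + h * (snd v \<bullet> snd I)" for v
    by (simp add: inner_prod_def f h inner_commute)
  have pair: "(a, b) \<bullet> v = a * fst v + b \<bullet> snd v" for a :: real and b :: "real^3" and v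
    by (simp add: inner_prod_def)
  have gB: "grad_normal_weight p \<bullet> v = grad_slice_weight p \<bullet> v + 8 * h * (snd v \<bullet> snd I)" for v
    unfolding grad_normal_weight_def inner_add_left pair by (simp add: h inner_commute)
  have re: "grad_real_coeff p = (4 / s ^ 3) *\<^sub>R p"
    using s by (simp add: grad_real_coeff_def gA A[unfolded A_def] field_simps eval_nat_numeral)
  define gi gm where "gi v = grad_imag_coeff p \<bullet> v" and "gm v = grad_radial_coeff p \<bullet> v" for v
  have key: "gi v = grad_real_coeff p \<bullet> v - 8 * h / (A * B) * (snd v \<bullet> snd I) - h\<^sup>2 * gm v" for v
  proof -
    define a y where "a = grad_slice_weight p \<bullet> v" and "y = 8 * h * (snd v \<bullet> snd I)"
    have h2: "h\<^sup>2 = (B - A) / 4"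
      by (simp add: B)
    have "gi v = - ((a + y) / B\<^sup>2)" "gm v = - 4 / (A * B)\<^sup>2 * (A * (a + y) + B * a)" "grad_real_coeff p \<bullet> v = - a / A\<^sup>2"
      by (simp_all add: gi_def gm_def grad_imag_coeff_def grad_radial_coeff_def grad_real_coeff_def gB inner_add_left
          A_def B_def a_def y_def)
    moreover have "8 * h / (A * B) * (snd v \<bullet> snd I) = y / (A * B)"
      by (simp add: y_def)
    moreover have "- ((a + y) / B\<^sup>2) = - a / A\<^sup>2 - y / (A * B)
        - (B - A) / 4 * (- 4 / (A * B)\<^sup>2 * (A * (a + y) + B * a))"
      using pos by (simp add: field_simps power2_eq_square)
    ultimately show ?thesis
      by (simp only: h2)
  qed
  define T where "T = 8 / (A * B)"
  have uI: "snd u \<bullet> snd I = u1" "snd w \<bullet> snd I = w1"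
    by (simp_all add: h i)
  define ku kw g where "ku = p \<bullet> u" and "kw = p \<bullet> w" and "g = u \<bullet> w"
  have g: "g = u0 * w0 + u1 * w1"
    by (simp add: g_def inner_prod_def f h i)
  have key': "gi v = 4 / s ^ 3 * (p \<bullet> v) - T * h * (snd v \<bullet> snd I) - h\<^sup>2 * gm v" for v
    unfolding key re by (simp add: T_def)
  have comp: "v \<bullet> koszul_vector p u w = 2 / s ^ 3 * (ku * (w0 * fst v + w1 * (snd v \<bullet> snd I))
      + kw * (u0 * fst v + u1 * (snd v \<bullet> snd I)) - g * (x * fst v + h * (snd v \<bullet> snd I)))" for v
  proof -
    define j where "j = snd v \<bullet> snd I"
    have *: "snd v \<bullet> snd w = w1 * j" "snd v \<bullet> snd u = u1 * j" "snd v \<bullet> snd p = h * j"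
      by (simp_all add: h j_def)
    have "v \<bullet> koszul_vector p u w = (1/2) * ((4 / s ^ 3 * ku * w0 + 4 / s ^ 3 * kw * u0) * fst v
        + (gi u * (w1 * j) + gi w * (u1 * j) + (gm u * (w1 * h) + gm w * (u1 * h) + T * (u1 * w1)) * (h * j))
        - (u0 * w0 * (4 / s ^ 3 * (p \<bullet> v)) + u1 * w1 * gi v + (u1 * h) * (w1 * h) * gm v))"
      unfolding koszul_vector_def inner_commute[of v] inner_scaleR_left inner_diff_left inner_add_left pair
        re gi_def[symmetric] gm_def[symmetric] A_def[symmetric] B_def[symmetric] T_def[symmetric]
        inner_commute[of _ "snd v"] * f
      by (simp add: h i ku_def kw_def j_def inner_add_right algebra_simps)
    also have "\<dots> = 2 / s ^ 3 * (ku * (w0 * fst v + w1 * j) + kw * (u0 * fst v + u1 * j) - g * (p \<bullet> v))"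
      unfolding key' uI j_def[symmetric] ku_def[symmetric] kw_def[symmetric] g
      by algebra
    finally show ?thesis
      by (simp add: pu j_def)
  qed
  define c where "c = 2 / s ^ 3"
  have c: "A * c = 2 / s"
    using s by (simp add: A c_def field_simps eval_nat_numeral)
  define e0 e1 where "e0 = c * (ku * w0 + kw * u0 - g * x)" and "e1 = c * (ku * w1 + kw * u1 - g * h)"
  have low: "koszul_vector p u w = (e0, e1 *\<^sub>R snd I)"
  proof (rule iffD1[OF vector_eq_ldot], rule allI)
    fix v
    show "v \<bullet> koszul_vector p u w = v \<bullet> (e0, e1 *\<^sub>R snd I)"
      unfolding comp inner_commute[of v "(e0, e1 *\<^sub>R snd I)"] pair c_def[symmetric]
      by (simp add: e0_def e1_def inner_commute algebra_simps)
  qed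
  have "snd (g_connection p u w) = (B * e1 - 4 * e1 * h * h) *\<^sub>R snd I"
    unfolding g_connection_def sharp_def low by (simp add: B_def h i scaleR_left_diff_distrib mult_ac)
  also have "B * e1 - 4 * e1 * h * h = A * e1"
    unfolding B by algebra
  finally have "g_connection p u w = (A * e0, (A * e1) *\<^sub>R snd I)"
    by (simp add: prod_eq_iff) (simp add: g_connection_def sharp_def low A_def)
  moreover have "A * e0 = 2 / s * (ku * w0 + kw * u0 - g * x)" "A * e1 = 2 / s * (ku * w1 + kw * u1 - g * h)"
    unfolding c[symmetric] e0_def e1_def by simp_all
  ultimately show ?thesis
    unfolding radial_connection_def inner_commute[of u p] inner_commute[of w p] n_def[symmetric]
      s_def[symmetric] ku_def[symmetric] kw_def[symmetric] g_def[symmetric]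
    by (simp add: prod_eq_iff f h algebra_simps)
qed

lemma geodesic_plane_perp:
  assumes J: "J \<in> im_units"
  shows "geodesic_plane qball g_metric g_connection ((qslice J)\<^sup>\<bottom>)"
proof -
  interpret levi_civita qball g_metric g_connection by (rule levi_civita_g)
  show ?thesis
  proof
    show "subspace ((qslice J)\<^sup>\<bottom>)" "dim ((qslice J)\<^sup>\<bottom>) = 2"
      by (rule qslice_perp_plane[OF J])+
    then show "g_connection y u v \<in> (qslice J)\<^sup>\<bottom>"
      if "y \<in> qball" "y \<in> (qslice J)\<^sup>\<bottom>" "u \<in> (qslice J)\<^sup>\<bottom>" "v \<in> (qslice J)\<^sup>\<bottom>" for y u v
      unfolding g_connection_perp[OF J that] radial_connection_def using that
      by (intro subspace_add subspace_mul)
  qed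
qed

lemma geodesic_plane_slice:
  assumes I: "I \<in> im_units"
  shows "geodesic_plane qball g_metric g_connection (qslice I)"
proof -
  interpret levi_civita qball g_metric g_connection by (rule levi_civita_g)
  show ?thesis
  proof
    show "subspace (qslice I)" "dim (qslice I) = 2"
      by (rule qslice_plane[OF I])+
    then show "g_connection y u v \<in> qslice I"
      if "y \<in> qball" "y \<in> qslice I" "u \<in> qslice I" "v \<in> qslice I" for y u v
      unfolding g_connection_slice[OF I that] radial_connection_def using that
      by (intro subspace_add subspace_mul)
  qed
qed

lemma curvature_perp:
  assumes J: "J \<in> im_units" and p: "p \<in> qball" "p \<in> (qslice J)\<^sup>\<bottom>"
    and uv: "u \<in> (qslice J)\<^sup>\<bottom>" "v \<in> (qslice J)\<^sup>\<bottom>"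
  shows "g_metric p (riemann g_metric p u v v) u =
    8 * ((1 - p \<bullet> p) / (1 + p \<bullet> p))\<^sup>2 * (g_metric p u u * g_metric p v v - (g_metric p u v)\<^sup>2)"
proof -
  interpret geodesic_plane qball g_metric g_connection "(qslice J)\<^sup>\<bottom>"
    by (rule geodesic_plane_perp[OF J])
  define n where "n = p \<bullet> p"
  have n: "0 \<le> n" "n < 1"
    using p by (auto simp: n_def qball_iff)
  have pos: "1 - n \<noteq> 0" "1 + n \<noteq> 0" using n by auto
  have fst_p: "fst p = 0"
    using p(2) qslice_perp_iff[OF J] by simp
  have A: "slice_weight p = (1 - n)\<^sup>2"
    by (simp add: slice_weight_def n_def)
  have "normal_weight p = (1 - n)\<^sup>2 + 4 * n"
    using fst_p by (simp add: normal_weight_def A) (simp add: n_def inner_prod_def)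
  also have "\<dots> = (1 + n)\<^sup>2"
    by algebra
  finally have B: "normal_weight p = (1 + n)\<^sup>2" .
  \<comment> \<open>in lowest terms the curvature coefficients of the disc are \<open>8 (1 + n\<^sup>2) / t\<^sup>4\<close>, \<open>16 / t\<^sup>4\<close> and \<open>- 16 / t\<^sup>4\<close>\<close>
  define s t where "s = 1 - n" and "t = 1 + n"
  have st: "s \<noteq> 0" "t \<noteq> 0" using n by (auto simp: s_def t_def)
  have "(6 + 2 * n\<^sup>2) / t ^ 3 - - 2 / t + - 2 / t * ((6 + 2 * n\<^sup>2) / t ^ 3) * n =
      ((6 + 2 * n\<^sup>2) * t + 2 * t ^ 3 - 2 * (6 + 2 * n\<^sup>2) * n) / t ^ 4"
    using st by (simp add: field_simps eval_nat_numeral)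
  also have "(6 + 2 * n\<^sup>2) * t + 2 * t ^ 3 - 2 * (6 + 2 * n\<^sup>2) * n = 8 * (1 + n\<^sup>2)"
    unfolding t_def by algebra
  finally have T: "8 * (1 + n\<^sup>2) / t ^ 4 = (6 + 2 * n\<^sup>2) / t ^ 3 - - 2 / t + - 2 / t * ((6 + 2 * n\<^sup>2) / t ^ 3) * n"
    by simp
  have "16 / (s * t ^ 3) - 2 * (2 / t\<^sup>2) + (- 2 / t)\<^sup>2 + - 2 / t * (16 / (s * t ^ 3)) * n =
      (16 * t - 32 * n) / (s * t ^ 4)"
    using st by (simp add: field_simps eval_nat_numeral)
  also have "16 * t - 32 * n = s * 16"
    by (simp add: s_def t_def)
  finally have W: "16 / t ^ 4 = 16 / (s * t ^ 3) - 2 * (2 / t\<^sup>2) + (- 2 / t)\<^sup>2 + - 2 / t * (16 / (s * t ^ 3)) * n"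
    using st by simp
  have "2 * ((4 * n - 2 * n\<^sup>2 - 18) / t ^ 4) - 16 / (s * t ^ 3)
      + ((6 + 2 * n\<^sup>2) / t ^ 3)\<^sup>2 + (6 + 2 * n\<^sup>2) / t ^ 3 * (16 / (s * t ^ 3)) * n =
      (2 * (4 * n - 2 * n\<^sup>2 - 18) * (s * t\<^sup>2) - 16 * t ^ 3 + (6 + 2 * n\<^sup>2)\<^sup>2 * s + 16 * n * (6 + 2 * n\<^sup>2)) / (s * t ^ 6)"
    using st by (simp add: field_simps eval_nat_numeral)
  also have "2 * (4 * n - 2 * n\<^sup>2 - 18) * (s * t\<^sup>2) - 16 * t ^ 3 + (6 + 2 * n\<^sup>2)\<^sup>2 * s + 16 * n * (6 + 2 * n\<^sup>2)
      = - 16 * (s * t\<^sup>2)"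
    unfolding s_def t_def by algebra
  also have "- 16 * (s * t\<^sup>2) / (s * t ^ 6) = - 16 / t ^ 4"
    using st by (simp add: field_simps eval_nat_numeral)
  finally have Z: "- 16 / t ^ 4 = 2 * ((4 * n - 2 * n\<^sup>2 - 18) / t ^ 4) - 16 / (s * t ^ 3)
      + ((6 + 2 * n\<^sup>2) / t ^ 3)\<^sup>2 + (6 + 2 * n\<^sup>2) / t ^ 3 * (16 / (s * t ^ 3)) * n"
    by simp
  have "(1 / t\<^sup>2) * (- 16 / t ^ 4) + 4 / (s\<^sup>2 * t\<^sup>2) * (8 * (1 + n\<^sup>2) / t ^ 4) + 4 / (s\<^sup>2 * t\<^sup>2) * (- 16 / t ^ 4) * n
      = (- 16 * s\<^sup>2 + 32 * (1 + n\<^sup>2) - 64 * n) / (s\<^sup>2 * t ^ 6)"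
    using st by (simp add: field_simps eval_nat_numeral)
  also have "- 16 * s\<^sup>2 + 32 * (1 + n\<^sup>2) - 64 * n = s\<^sup>2 * 16"
    unfolding s_def by algebra
  also have "s\<^sup>2 * 16 / (s\<^sup>2 * t ^ 6) = (1 / t\<^sup>2) * (16 / t ^ 4)"
    using st by (simp add: field_simps eval_nat_numeral)
  finally have 1: "(1 / t\<^sup>2) * (16 / t ^ 4) = (1 / t\<^sup>2) * (- 16 / t ^ 4)
      + 4 / (s\<^sup>2 * t\<^sup>2) * (8 * (1 + n\<^sup>2) / t ^ 4) + 4 / (s\<^sup>2 * t\<^sup>2) * (- 16 / t ^ 4) * n"
    by simp
  have "8 * (s / t)\<^sup>2 * (1 / t\<^sup>2 + 4 / (s\<^sup>2 * t\<^sup>2) * n) = 8 * (s\<^sup>2 + 4 * n) / t ^ 4"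
    using st by (simp add: field_simps eval_nat_numeral)
  also have "8 * (s\<^sup>2 + 4 * n) = 8 * (1 + n\<^sup>2) + 16 * n"
    unfolding s_def by algebra
  finally have 2: "8 * (s / t)\<^sup>2 * (1 / t\<^sup>2 + 4 / (s\<^sup>2 * t\<^sup>2) * n) = 8 * (1 + n\<^sup>2) / t ^ 4 + 16 / t ^ 4 * n"
    by (simp add: add_divide_distrib)
  have "g_metric p (riemann g_metric p u v v) u =
    8 * ((1 - n) / (1 + n))\<^sup>2 * (g_metric p u u * g_metric p v v - (g_metric p u v)\<^sup>2)"
  proof (rule curvature_radial[OF g_connection_perp[OF J] p _ _ _ _ n_def T[unfolded s_def t_def] W[unfolded s_def t_def]
        Z[unfolded s_def t_def] 1[unfolded s_def t_def] 2[unfolded s_def t_def] uv])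
    show "g_metric p u w = (1 / (1 + n)\<^sup>2) * (u \<bullet> w) + (4 / ((1 - n)\<^sup>2 * (1 + n)\<^sup>2)) * ((u \<bullet> p) * (w \<bullet> p))"
      if "u \<in> (qslice J)\<^sup>\<bottom>" "w \<in> (qslice J)\<^sup>\<bottom>" for u w
      using that p(2) qslice_perp_iff[OF J]
      by (simp add: g_metric_eq[OF p(1)] g_form_def A B inner_prod_def)
    show "((\<lambda>n. - 2 / (1 + n)) has_real_derivative 2 / (1 + n)\<^sup>2) (at (p \<bullet> p))"
      unfolding n_def[symmetric] using pos
      by (auto intro!: derivative_eq_intros simp: field_simps power2_eq_square)
    have D: "((\<lambda>n. (6 + 2 * n\<^sup>2) / (1 + n) ^ 3) has_real_derivative
        (4 * n * t ^ 3 - (6 + 2 * n\<^sup>2) * (3 * t\<^sup>2)) / (t ^ 3 * t ^ 3)) (at n)"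
      using st unfolding t_def by (auto intro!: derivative_eq_intros)
    have "(4 * n * t ^ 3 - (6 + 2 * n\<^sup>2) * (3 * t\<^sup>2)) / (t ^ 3 * t ^ 3) =
        (4 * n * t - 3 * (6 + 2 * n\<^sup>2)) / t ^ 4"
      using st by (simp add: field_simps eval_nat_numeral)
    also have "4 * n * t - 3 * (6 + 2 * n\<^sup>2) = 4 * n - 2 * n\<^sup>2 - 18"
      unfolding t_def by algebra
    finally show "((\<lambda>n. (6 + 2 * n\<^sup>2) / (1 + n) ^ 3) has_real_derivative
        (4 * n - 2 * n\<^sup>2 - 18) / (1 + n) ^ 4) (at (p \<bullet> p))"
      using D by (simp only: n_def[symmetric] t_def[symmetric])
    have D: "((\<lambda>n. 16 / ((1 - n) * (1 + n) ^ 3)) has_real_derivative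
        - (16 * (s * (3 * t\<^sup>2) - t ^ 3)) / ((s * t ^ 3) * (s * t ^ 3))) (at n)"
      using st unfolding s_def t_def by (auto intro!: derivative_eq_intros)
    have "- (16 * (s * (3 * t\<^sup>2) - t ^ 3)) / ((s * t ^ 3) * (s * t ^ 3)) = 16 * (t - 3 * s) / (s\<^sup>2 * t ^ 4)"
      using st by (simp add: field_simps eval_nat_numeral)
    also have "t - 3 * s = 4 * n - 2"
      by (simp add: s_def t_def)
    finally show "((\<lambda>n. 16 / ((1 - n) * (1 + n) ^ 3)) has_real_derivative
        16 * (4 * n - 2) / ((1 - n)\<^sup>2 * (1 + n) ^ 4)) (at (p \<bullet> p))"
      using D by (simp only: n_def[symmetric] s_def[symmetric] t_def[symmetric])
  qed
  then show ?thesis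
    by (simp add: n_def)
qed

lemma curvature_slice:
  assumes I: "I \<in> im_units" and p: "p \<in> qball" "p \<in> qslice I"
    and uv: "u \<in> qslice I" "v \<in> qslice I"
  shows "g_metric p (riemann g_metric p u v v) u =
    - 4 * (g_metric p u u * g_metric p v v - (g_metric p u v)\<^sup>2)"
proof -
  interpret geodesic_plane qball g_metric g_connection "qslice I"
    by (rule geodesic_plane_slice[OF I])
  define n where "n = p \<bullet> p"
  have n: "n < 1"
    using p by (simp add: n_def qball_iff)
  define s where "s = 1 - n"
  have s: "s \<noteq> 0" using n by (simp add: s_def)
  have "- 2 / s - 2 / s + 2 / s * (- 2 / s) * n = - 4 * (s + n) / s\<^sup>2"
    using s by (simp add: field_simps power2_eq_square)
  also have "s + n = 1"
    by (simp add: s_def)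
  finally have T: "- 4 / (1 - n)\<^sup>2 = - 2 / (1 - n) - 2 / (1 - n) + 2 / (1 - n) * (- 2 / (1 - n)) * n"
    by (simp add: s_def)
  have W: "0 = 0 - 2 * (2 / (1 - n)\<^sup>2) + (2 / (1 - n))\<^sup>2 + 2 / (1 - n) * 0 * n"
    and Z: "0 = 2 * (- 2 / (1 - n)\<^sup>2) - 0 + (- 2 / (1 - n))\<^sup>2 + - 2 / (1 - n) * 0 * n"
    by (simp_all add: power_divide)
  show ?thesis
  proof (rule curvature_radial[OF g_connection_slice[OF I] p _ _ _ _ n_def T W Z _ _ uv])
    show "g_metric p u w = (1 / (1 - n)\<^sup>2) * (u \<bullet> w) + 0 * ((u \<bullet> p) * (w \<bullet> p))"
      if uw: "u \<in> qslice I" "w \<in> qslice I" for u w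
    proof -
      obtain h u1 w1 where h: "snd p = h *\<^sub>R snd I" "snd u = u1 *\<^sub>R snd I" "snd w = w1 *\<^sub>R snd I"
        using uw p(2) qslice_iff[OF I] by auto
      have i: "snd I \<bullet> snd I = 1"
        using I by (simp add: im_units_iff)
      have A: "slice_weight p = (1 - n)\<^sup>2" by (simp add: slice_weight_def n_def)
      have BA: "normal_weight p = slice_weight p + 4 * h\<^sup>2"
        by (simp add: normal_weight_def h i power2_eq_square)
      have "u1 * w1 / normal_weight p + 4 * (u1 * h) * (w1 * h) / (slice_weight p * normal_weight p) = u1 * w1 * (slice_weight p + 4 * h\<^sup>2) / (slice_weight p * normal_weight p)"
        using slice_weight_pos[OF p(1)] normal_weight_pos[OF p(1)] by (simp add: field_simps power2_eq_square)
      also have "\<dots> = u1 * w1 / slice_weight p"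
        using normal_weight_pos[OF p(1)] by (simp flip: BA)
      finally show ?thesis
        by (simp add: g_metric_eq[OF p(1)] g_form_def h i A[symmetric] inner_prod_def add_divide_distrib mult_ac)
    qed
    show "((\<lambda>n. 2 / (1 - n)) has_real_derivative 2 / (1 - n)\<^sup>2) (at (p \<bullet> p))"
      unfolding n_def[symmetric] using n
      by (auto intro!: derivative_eq_intros simp: field_simps power2_eq_square)
    show "((\<lambda>n. - 2 / (1 - n)) has_real_derivative - 2 / (1 - n)\<^sup>2) (at (p \<bullet> p))"
      unfolding n_def[symmetric] using n
      by (auto intro!: derivative_eq_intros simp: field_simps power2_eq_square)
    show "((\<lambda>n. 0) has_real_derivative 0) (at (p \<bullet> p))"
      by simp
  qed simp_all
qed

theorem mainTheorem9:
  shows "(\<forall>J\<in>im_units. \<forall>p\<in>disc_section J. gaussian_curvature g_metric (disc_section J) p > 0)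
       \<and> (\<forall>J\<in>im_units. \<forall>p\<in>disc_section J.
            sectional_curvature g_metric p (tangent_space (disc_section J) p) > 0)
       \<and> (\<forall>I\<in>im_units. \<forall>p\<in>ball_slice I.
            sectional_curvature g_metric p (tangent_space (ball_slice I) p) < 0)"
proof (intro conjI ballI)
  fix J p assume J: "J \<in> im_units" and "p \<in> disc_section J"
  then have p: "p \<in> qball" "p \<in> (qslice J)\<^sup>\<bottom>"
    by (auto simp: disc_section_eq)
  interpret geodesic_plane qball g_metric g_connection "(qslice J)\<^sup>\<bottom>"
    by (rule geodesic_plane_perp[OF J])
  have pos: "0 < 8 * ((1 - p \<bullet> p) / (1 + p \<bullet> p))\<^sup>2"
    using p(1) inner_ge_zero[of p] by (simp add: qball_iff zero_less_power2 add_nonneg_eq_0_iff)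
  have "gaussian_curvature g_metric (disc_section J) p = 8 * ((1 - p \<bullet> p) / (1 + p \<bullet> p))\<^sup>2"
    unfolding disc_section_eq[OF J] using p curvature_perp[OF J p] by (rule gaussian_curvature_plane)
  with pos show "gaussian_curvature g_metric (disc_section J) p > 0"
    by simp
  have "sectional_curvature g_metric p ((qslice J)\<^sup>\<bottom>) = 8 * ((1 - p \<bullet> p) / (1 + p \<bullet> p))\<^sup>2"
    using bilinear_G[OF p(1)] sym_G[OF p(1)] pos_G[OF p(1)] subspace_P dim_P curvature_perp[OF J p]
    by (rule sectional_curvature_eqI)
  with pos show "sectional_curvature g_metric p (tangent_space (disc_section J) p) > 0"
    by (simp add: disc_section_eq[OF J] tangent_space_plane[OF open_S subspace_P p])
next
  fix I p assume I: "I \<in> im_units" and "p \<in> ball_slice I"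
  then have p: "p \<in> qball" "p \<in> qslice I"
    by (auto simp: ball_slice_def)
  interpret geodesic_plane qball g_metric g_connection "qslice I"
    by (rule geodesic_plane_slice[OF I])
  have "sectional_curvature g_metric p (qslice I) = - 4"
    using bilinear_G[OF p(1)] sym_G[OF p(1)] pos_G[OF p(1)] subspace_P dim_P curvature_slice[OF I p]
    by (rule sectional_curvature_eqI)
  then show "sectional_curvature g_metric p (tangent_space (ball_slice I) p) < 0"
    by (simp add: ball_slice_def tangent_space_plane[OF open_S subspace_P p])
qed

end
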